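(* Let $m,d\in\mathbb{N}$ and let $d_1,\dots,d_m$ be integers with $0=d_1<d_2<\dots<d_m=2d$. Put $\mathsf{A}=\{1,x^{d_2},\dots,x^{d_m}\}$ (considered on $\mathbb{R}$) and $\mathsf{B}=\{y^{2d},x^{d_2}y^{2d-d_2},\dots,x^{d_{m-1}}y^{2d-d_{m-1}},x^{2d}\}$ (considered on the real projective line $\mathbb{P}(\mathbb{R})$). Let $k=\lceil m/2\rceil$, and let $\mathcal{Z}\subseteq\mathbb{R}^k$ be the real zero set $\mathcal{Z}:=\mathcal{Z}(q_{\mathsf{A}})$ if $m=2k$ is even, and $\mathcal{Z}:=\mathcal{Z}(q_{\mathsf{A},1})\cap\dots\cap\mathcal{Z}(q_{\mathsf{A},k})$ if $m=2k-1$ is odd. Suppose that $$(x_1,\dots,x_k)\in\mathcal{Z}\ \Longrightarrow\ \exists\, i\neq j:\ x_i=x_j .$$ Then $$\mathcal{C}_{\mathsf{A}}=\mathcal{C}_{\mathsf{B}}=\mathcal{N}_{\mathsf{A}}=\mathcal{N}_{\mathsf{B}}=\left\lceil\frac{m}{2}\right\rceil .$$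
   Context: Schur-type polynomials: for $\mathsf{A}=\{x^{d_1},\dots,x^{d_m}\}$ with $0\le d_1<\dots<d_m$, $p_{\mathsf{A}}$ is the unique polynomial with $$\det\big(x_i^{d_j}\big)_{i,j=1}^m=(x_1\cdots x_m)^{d_1}\prod_{1\le i<j\le m}(x_j-x_i)\cdot p_{\mathsf{A}}(x_1,\dots,x_m).$$ If $m=2k$, set $q_{\mathsf{A}}(x_1,\dots,x_k):=p_{\mathsf{A}}(x_1,x_1,\dots,x_k,x_k)$. If $m=2k-1$, set for $i=1,\dots,k$: $q_{\mathsf{A},i}(x_1,\dots,x_k):=p_{\mathsf{A}}(x_1,x_1,\dots,x_{i-1},x_{i-1},x_i,x_{i+1},x_{i+1},\dots,x_k,x_k)$ (every variable is doubled except $x_i$). $\mathcal{Z}(\cdot)$ denotes the set of real zeros. Carathéodory number: let $\mathsf{F}=\{f_1,\dots,f_m\}$ be a linearly independent finite set of continuous functions on $\mathcal{X}$. A vector $s=(s_j)_{j=1}^m\in\mathbb{R}^m$ is a moment sequence of $\mathsf{F}$ if there is a positive Radon measure $\mu$ on $\mathcal{X}$ such that all $f_j$ are $\mu$-integrable and $s_j=\int f_j\,d\mu$ for all $j$; $\mu$ is then a representing measure of $s$. A $k$-atomic measure is $\sum_{i=1}^k c_i\delta_{x_i}$ with pairwise different $x_i\in\mathcal{X}$ and all $c_i>0$ (the zero measure is $0$-atomic). $\mathcal{C}_{\mathsf{F}}$ is the smallest number such that every moment sequence of $\mathsf{F}$ has a $k$-atomic representing measure with $k\le\mathcal{C}_{\mathsf{F}}$.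 For $\mathsf{A}$ we take $\mathcal{X}=\mathbb{R}$; for the homogeneous $\mathsf{B}$ we take $\mathcal{X}=\mathbb{P}(\mathbb{R})$, realized as the set of points of the unit circle in $\mathbb{R}^2$ whose first non-vanishing coordinate is positive, polynomials being evaluated at these representatives. The number $\mathcal{N}_{\mathsf{F}}$: for differentiable functions $f_1,\dots,f_m$ on $\mathbb{R}^n$ (here $n=1$ for $\mathsf{A}$, $n=2$ for $\mathsf{B}$) let $s_{\mathsf{F}}(x)=(f_1(x),\dots,f_m(x))^T$ and $S_{k,\mathsf{F}}(C,X)=\sum_{i=1}^k c_i s_{\mathsf{F}}(x_i)$ for $C=(c_1,\dots,c_k)$, $X=(x_1,\dots,x_k)$, $c_i\ge0$, $x_i\in\mathbb{R}^n$; $DS_{k,\mathsf{F}}$ is the total derivative of $S_{k,\mathsf{F}}$ with respect to all $c_i$ and all coordinates of all $x_i$. $\mathcal{N}_{\mathsf{F}}$ is the smallest $k\in\mathbb{N}$ such that $DS_{k,\mathsf{F}}(C,X)$ has rank $m$ for some $(C,X)$. *)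

theory Defs
  imports "HOL-Analysis.Analysis" "Jordan_Normal_Form.DL_Rank" "Jordan_Normal_Form.Determinant"
begin

hide_const (open) Determinants.det Finite_Cartesian_Product.mat Finite_Cartesian_Product.vec
  Finite_Cartesian_Product.row Finite_Cartesian_Product.column

(* Throughout, a point of R^m is a function on nat of which only the values at indices < m
   matter, a family f_1, ..., f_m is a function f of an index j < m, and indices start at 0. *)

subsection \<open>Schur-type polynomials\<close>

definition polynomial_fun :: "nat \<Rightarrow> ((nat \<Rightarrow> real) \<Rightarrow> real) \<Rightarrow> bool" where
  "polynomial_fun m p \<longleftrightarrow>
     (\<exists>(E :: (nat \<Rightarrow> nat) set) c. finite E \<and> p = (\<lambda>x. \<Sum>\<alpha>\<in>E. c \<alpha> * (\<Prod>i<m. x i ^ \<alpha> i)))"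

(* Real polynomials in m variables are identified with the functions they induce on R^m. *)
definition schur_poly :: "nat \<Rightarrow> (nat \<Rightarrow> nat) \<Rightarrow> (nat \<Rightarrow> real) \<Rightarrow> real" where
  "schur_poly m e = (THE p. polynomial_fun m p \<and>
     (\<forall>x. Determinant.det (Matrix.mat m m (\<lambda>(i, j). x i ^ e j)) =
          (\<Prod>i<m. x i) ^ e 0 * (\<Prod>j<m. \<Prod>i<j. x j - x i) * p x))"

definition schur_even :: "nat \<Rightarrow> (nat \<Rightarrow> nat) \<Rightarrow> (nat \<Rightarrow> real) \<Rightarrow> real" where
  "schur_even k e x = schur_poly (2 * k) e (\<lambda>l. x (l div 2))"

(* The arguments are x_0, x_0, ..., x_(i-1), x_(i-1), x_i, x_(i+1), x_(i+1), ...: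
   the undoubled x_i is at position 2 * i, and x_r with r > i is at positions 2 * r - 1, 2 * r. *)
definition schur_odd :: "nat \<Rightarrow> (nat \<Rightarrow> nat) \<Rightarrow> nat \<Rightarrow> (nat \<Rightarrow> real) \<Rightarrow> real" where
  "schur_odd k e i x =
     schur_poly (2 * k - 1) e (\<lambda>l. if l \<le> 2 * i then x (l div 2) else x ((l + 1) div 2))"

definition schur_zeros :: "nat \<Rightarrow> (nat \<Rightarrow> nat) \<Rightarrow> (nat \<Rightarrow> real) set" where
  "schur_zeros m e = (let k = nat \<lceil>real m / 2\<rceil> in
     if even m then {x. schur_even k e x = 0}
     else (\<Inter>i<k. {x. schur_odd k e i x = 0}))"

subsection \<open>Moment sequences and the Caratheodory number\<close>

definition borel_top :: "'a topology \<Rightarrow> 'a measure" where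
  "borel_top T = sigma (topspace T) {U. openin T U}"

definition radon_measure :: "'a topology \<Rightarrow> 'a measure \<Rightarrow> bool" where
  "radon_measure T M \<longleftrightarrow>
     sets M = sets (borel_top T) \<and>
     (\<forall>K. compactin T K \<longrightarrow> emeasure M K < \<infinity>) \<and>
     (\<forall>B\<in>sets M. emeasure M B = (SUP K\<in>{K. compactin T K \<and> K \<subseteq> B}. emeasure M K))"

definition representing_measure ::
    "'a topology \<Rightarrow> nat \<Rightarrow> (nat \<Rightarrow> 'a \<Rightarrow> real) \<Rightarrow> (nat \<Rightarrow> real) \<Rightarrow> 'a measure \<Rightarrow> bool" where
  "representing_measure T m f s M \<longleftrightarrow>
     radon_measure T M \<and> (\<forall>j<m. integrable M (f j) \<and> s j = integral\<^sup>L M (f j))"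

definition moment_sequence ::
    "'a topology \<Rightarrow> nat \<Rightarrow> (nat \<Rightarrow> 'a \<Rightarrow> real) \<Rightarrow> (nat \<Rightarrow> real) \<Rightarrow> bool" where
  "moment_sequence T m f s \<longleftrightarrow> (\<exists>M. representing_measure T m f s M)"

definition atomic_measure :: "'a topology \<Rightarrow> nat \<Rightarrow> 'a measure \<Rightarrow> bool" where
  "atomic_measure T k M \<longleftrightarrow>
     sets M = sets (borel_top T) \<and>
     (\<exists>c x. inj_on x {..<k} \<and> (\<forall>i<k. x i \<in> topspace T \<and> (c i :: real) > 0) \<and>
        (\<forall>B\<in>sets M. emeasure M B = (\<Sum>i<k. ennreal (c i) * indicator B (x i))))"

definition caratheodory_number :: "'a topology \<Rightarrow> nat \<Rightarrow> (nat \<Rightarrow> 'a \<Rightarrow> real) \<Rightarrow> nat" where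
  "caratheodory_number T m f =
     (LEAST N. \<forall>s. moment_sequence T m f s \<longrightarrow>
        (\<exists>k\<le>N. \<exists>M. atomic_measure T k M \<and> representing_measure T m f s M))"

subsection \<open>The real projective line\<close>

definition proj_line :: "(real \<times> real) set" where
  "proj_line = {(x, y). (x, y) \<in> sphere 0 1 \<and> (x > 0 \<or> x = 0 \<and> y > 0)}"

(* The quotient topology of the circle modulo antipodes (not the subspace topology of this
   half-open arc): U Un -U is the preimage of U under the map sending a point of the circle to
   its representative. *)
definition proj_topology :: "(real \<times> real) topology" where
  "proj_topology =
     topology (\<lambda>U. U \<subseteq> proj_line \<and> openin (top_of_set (sphere 0 1)) (U \<union> uminus ` U))"

lemma openin_proj_topology:
  "openin proj_topology U \<longleftrightarrow>
     U \<subseteq> proj_line \<and> openin (top_of_set (sphere 0 1)) (U \<union> uminus ` U)"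
proof -
  let ?P = "\<lambda>U. U \<subseteq> proj_line \<and> openin (top_of_set (sphere 0 1)) (U \<union> uminus ` U)"
  have disj: "- p \<notin> proj_line" if "p \<in> proj_line" for p
    using that by (auto simp: proj_line_def)
  have "istopology ?P"
    unfolding istopology_def
  proof (intro conjI allI impI)
    fix U V assume U: "?P U" and V: "?P V"
    then show "U \<inter> V \<subseteq> proj_line" by blast
    have "(U \<inter> V) \<union> uminus ` (U \<inter> V) = (U \<union> uminus ` U) \<inter> (V \<union> uminus ` V)"
    proof -
      have "U \<inter> uminus ` V = {}" "V \<inter> uminus ` U = {}"
        using U V disj by blast+
      moreover have "uminus ` (U \<inter> V) = uminus ` U \<inter> uminus ` V"
        by (rule image_Int) simp
      ultimately show ?thesis by blast
    qed
    then show "openin (top_of_set (sphere 0 1)) ((U \<inter> V) \<union> uminus ` (U \<inter> V))"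
      using U V by (simp add: openin_Int)
  next
    fix \<K> assume K: "\<forall>U\<in>\<K>. ?P U"
    then show "\<Union>\<K> \<subseteq> proj_line" by blast
    have "\<Union>\<K> \<union> uminus ` \<Union>\<K> = (\<Union>U\<in>\<K>. U \<union> uminus ` U)" by blast
    then show "openin (top_of_set (sphere 0 1)) (\<Union>\<K> \<union> uminus ` \<Union>\<K>)"
      using K by (auto intro!: openin_Union)
  qed
  then show ?thesis
    unfolding proj_topology_def by (simp add: topology_inverse')
qed

lemma topspace_proj_topology: "topspace proj_topology = proj_line"
proof -
  have "proj_line \<union> uminus ` proj_line = sphere 0 1"
  proof
    show "proj_line \<union> uminus ` proj_line \<subseteq> sphere 0 1"
    proof
      fix p assume "p \<in> proj_line \<union> uminus ` proj_line"
      then obtain q where "q \<in> sphere 0 1" "p = q \<or> p = - q"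
        unfolding proj_line_def by blast
      then show "p \<in> sphere 0 1"
        by (auto simp: dist_norm)
    qed
    show "sphere 0 1 \<subseteq> proj_line \<union> uminus ` proj_line"
    proof
      fix p :: "real \<times> real" assume p: "p \<in> sphere 0 1"
      have "p \<in> proj_line \<or> - p \<in> proj_line"
        using p by (cases p) (auto simp: proj_line_def norm_Pair power2_eq_1_iff)
      then show "p \<in> proj_line \<union> uminus ` proj_line"
        by (metis UnI1 UnI2 add.inverse_inverse imageI)
    qed
  qed
  then have "openin proj_topology proj_line"
    by (simp add: openin_proj_topology)
  then show ?thesis
    by (metis openin_proj_topology openin_subset openin_topspace subset_antisym)
qed

subsection \<open>The rank number\<close>

(* The j-th component of S_k(C, X). *)
definition moment_map ::
    "(nat \<Rightarrow> 'a \<Rightarrow> real) \<Rightarrow> nat \<Rightarrow> (nat \<Rightarrow> real) \<Rightarrow> (nat \<Rightarrow> 'a) \<Rightarrow> nat \<Rightarrow> real" where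
  "moment_map f k C X j = (\<Sum>i<k. C i * f j (X i))"

(* An enumeration of the coordinate directions; the rank below does not depend on its order. *)
definition Basis_list :: "'a :: euclidean_space list" where
  "Basis_list = (SOME bs. distinct bs \<and> set bs = Basis)"

(* The m x (k + k * DIM('a)) matrix of the total derivative of S_k at (C, X): for each i < k the
   column of partial derivatives in c_i, followed by those in the coordinates of x_i. *)
definition moment_jacobian :: "nat \<Rightarrow> (nat \<Rightarrow> 'a :: euclidean_space \<Rightarrow> real) \<Rightarrow> nat \<Rightarrow>
    (nat \<Rightarrow> real) \<Rightarrow> (nat \<Rightarrow> 'a) \<Rightarrow> real Matrix.mat" where
  "moment_jacobian m f k C X = mat_of_cols m (concat (map (\<lambda>i.
     Matrix.vec m (\<lambda>j. deriv (\<lambda>t. moment_map f k (C(i := t)) X j) (C i)) #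
     map (\<lambda>b. Matrix.vec m (\<lambda>j. deriv (\<lambda>t. moment_map f k C (X(i := X i + t *\<^sub>R b)) j) 0))
       Basis_list) [0..<k]))"

definition rank_number :: "nat \<Rightarrow> (nat \<Rightarrow> 'a :: euclidean_space \<Rightarrow> real) \<Rightarrow> nat" where
  "rank_number m f =
     (LEAST k. \<exists>C X. (\<forall>i<k. C i \<ge> 0) \<and> vec_space.rank m (moment_jacobian m f k C X) = m)"

subsection \<open>The monomial families\<close>

definition monomials :: "(nat \<Rightarrow> nat) \<Rightarrow> nat \<Rightarrow> real \<Rightarrow> real" where
  "monomials e j x = x ^ e j"

definition hom_monomials :: "nat \<Rightarrow> (nat \<Rightarrow> nat) \<Rightarrow> nat \<Rightarrow> real \<times> real \<Rightarrow> real" where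
  "hom_monomials n e j = (\<lambda>(x, y). x ^ e j * y ^ (n - e j))"

end

theory Submission
  imports Defs
begin

text \<open>Let \<open>k\<close> be the upper integer part of \<open>m / 2\<close>. Everything rests on one consequence of the
hypothesis, called Hermite unisolvence below (\<open>hermite_unisolvent_if_schur_zeros\<close>): for any
\<open>k\<close> distinct reals, only the zero combination of the monomials has double zeros at all of them, and
every assignment of values at these points is attained by some combination. Indeed the Schur-type
polynomial is the determinant of the Newton divided differences of the monomials. Divided
differences, unlike the quotient of the two determinants, make sense at repeated nodes, and this
determinant vanishes at a list of nodes exactly if some non-zero combination of the monomials is
divisible by the product of the corresponding linear factors.

The rank of the derivative of the moment map is full exactly if no non-zero coefficient vector is
orthogonal to all its columns (\<open>rank_mat_of_cols_eq_iff\<close>). For points on the line, orthogonality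
means a double zero at every atom, so unisolvence gives the upper bound \<open>k\<close>, and each atom
imposes only two conditions, which gives the lower bound. In the homogeneous case Euler's identity
makes one of the three conditions per atom redundant.

For the upper bound on the Caratheodory numbers, let \<open>L\<close> be the functional on the span that is given
by a moment sequence. A non-negative combination has a double zero wherever it vanishes, hence fewer
than \<open>k\<close> real zeros. If \<open>L\<close> vanishes at a non-zero non-negative combination, then every representing
measure sits on the zeros of this combination (\<open>moments_concentrated_on_zeros\<close>). Otherwise \<open>L\<close> is
strictly positive. Then an atom is split off at a point \<open>N\<close> with the largest mass that keeps the
remainder non-negative; the remainder vanishes at some non-negative \<open>f\<close> with \<open>f(N) > 0\<close>, and for
large \<open>N\<close> the leading coefficient of \<open>f\<close> cannot be zero. So \<open>f\<close> does not vanish at infinity, and a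
perturbation argument shows that the remainder is carried by the fewer than \<open>k\<close> real zeros of \<open>f\<close>
(\<open>interior_functional_atoms\<close>). Such an \<open>f\<close> is found by minimising \<open>L\<close> on a compact set of
coefficients. On the projective line one further zero, the point at infinity, may occur in the first
case, and the count is still at most \<open>k\<close>.

For the lower bound (\<open>few_atoms_insufficient\<close>), sums of \<open>N\<close> atoms form a bounded family with \<open>2 N\<close>
real parameters once the total mass is bounded, so up to an error \<open>1 / R\<close> there are at most a
constant times \<open>R\<^sup>2\<^sup>N\<close> of them. But distributing masses from a grid of mesh \<open>1 / R\<close> over \<open>m\<close> fixed
atoms gives \<open>R\<^sup>m\<close> moment sequences that differ by at least \<open>1 / R\<close>. Hence \<open>m \<le> 2 N\<close>.\<close>

section \<open>Divided differences and the Schur-type polynomials\<close>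

text \<open>The quotient that remains after the linear factors of the first \<open>l\<close> nodes have been split off by
Horner's scheme. Defining divided differences in this way needs no case distinction for repeated
nodes.\<close>

fun newton_rem :: "(nat \<Rightarrow> real) \<Rightarrow> real poly \<Rightarrow> nat \<Rightarrow> real poly" where
  "newton_rem y f 0 = f"
| "newton_rem y f (Suc l) = synthetic_div (newton_rem y f l) (y l)"

definition divided_diff :: "(nat \<Rightarrow> real) \<Rightarrow> real poly \<Rightarrow> nat \<Rightarrow> real" where
  "divided_diff y f l = poly (newton_rem y f l) (y l)"

definition node_poly :: "(nat \<Rightarrow> real) \<Rightarrow> nat \<Rightarrow> real poly" where
  "node_poly y l = (\<Prod>q<l. [:- y q, 1:])"

text \<open>Newton's interpolation formula with remainder, valid for repeated nodes as well.\<close>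

lemma newton_form:
  "f = (\<Sum>r<l. Polynomial.smult (divided_diff y f r) (node_poly y r))
        + node_poly y l * newton_rem y f l"
proof (induction l)
  case 0
  show ?case by (simp add: node_poly_def)
next
  case (Suc l)
  have "newton_rem y f l = [:- y l, 1:] * newton_rem y f (Suc l) + [:divided_diff y f l:]"
    using synthetic_div_correct'[of "y l" "newton_rem y f l"] by (simp add: divided_diff_def)
  then have "node_poly y l * newton_rem y f l = node_poly y (Suc l) * newton_rem y f (Suc l)
      + Polynomial.smult (divided_diff y f l) (node_poly y l)"
    by (simp only: node_poly_def prod.lessThan_Suc distrib_left mult.assoc) simp
  with Suc show ?case by (simp only: sum.lessThan_Suc add.assoc)
qed

lemma synthetic_div_add:
  fixes p q :: "real poly"
  shows "synthetic_div (p + q) c = synthetic_div p c + synthetic_div q c"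
proof -
  have "(p + q) + Polynomial.smult c (synthetic_div p c + synthetic_div q c)
      = pCons (poly p c + poly q c) (synthetic_div p c + synthetic_div q c)"
    using synthetic_div_correct[of p c] synthetic_div_correct[of q c]
    by (simp add: smult_add_right flip: add_pCons)
  then show ?thesis using synthetic_div_unique by metis
qed

lemma synthetic_div_smult:
  fixes p :: "real poly"
  shows "synthetic_div (Polynomial.smult a p) c = Polynomial.smult a (synthetic_div p c)"
proof -
  have "Polynomial.smult a p + Polynomial.smult c (Polynomial.smult a (synthetic_div p c))
      = Polynomial.smult a (p + Polynomial.smult c (synthetic_div p c))"
    by (simp add: smult_add_right mult.commute)
  also have "\<dots> = pCons (a * poly p c) (Polynomial.smult a (synthetic_div p c))"
    using synthetic_div_correct[of p c] by simp
  finally show ?thesis using synthetic_div_unique by metis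
qed

lemma newton_rem_sum:
  "finite J \<Longrightarrow> newton_rem y (\<Sum>j\<in>J. Polynomial.smult (a j) (g j)) l
     = (\<Sum>j\<in>J. Polynomial.smult (a j) (newton_rem y (g j) l))"
proof (induction l)
  case (Suc l)
  have "synthetic_div (\<Sum>j\<in>J. Polynomial.smult (a j) (h j)) c
      = (\<Sum>j\<in>J. Polynomial.smult (a j) (synthetic_div (h j) c))" for h c
    using Suc.prems by (induction J rule: finite_induct)
      (simp_all add: synthetic_div_add synthetic_div_smult)
  with Suc show ?case by simp
qed simp

lemma divided_diff_sum:
  "finite J \<Longrightarrow> divided_diff y (\<Sum>j\<in>J. Polynomial.smult (a j) (g j)) l
     = (\<Sum>j\<in>J. divided_diff y (g j) l * a j)"
  by (simp add: divided_diff_def newton_rem_sum poly_sum mult.commute)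

text \<open>If the linear factors of all nodes divide \<open>f\<close>, each Horner step is an exact division, so all
remainders vanish.\<close>

lemma divided_diff_eq_0_if_dvd:
  assumes "node_poly y m dvd f" and "l < m"
  shows "divided_diff y f l = 0"
proof -
  have "(\<Prod>r\<in>{l..<m}. [:- y r, 1:]) dvd newton_rem y f l" if "l \<le> m" for l
    using that
  proof (induction l)
    case 0
    then show ?case using assms(1) by (simp add: node_poly_def atLeast0LessThan)
  next
    case (Suc l)
    then obtain h where h: "newton_rem y f l = (\<Prod>r\<in>{l..<m}. [:- y r, 1:]) * h" by auto
    have eq: "newton_rem y f l = [:- y l, 1:] * ((\<Prod>r\<in>{Suc l..<m}. [:- y r, 1:]) * h)"
      using Suc.prems h prod.atLeast_Suc_lessThan[of l m "\<lambda>r. [:- y r, 1:]"] by (simp only: mult.assoc)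
    have "poly (newton_rem y f l) (y l) = 0" unfolding eq by simp
    then have "[:- y l, 1:] * synthetic_div (newton_rem y f l) (y l) = newton_rem y f l"
      using synthetic_div_correct'[of "y l" "newton_rem y f l"] by simp
    then have "[:- y l, 1:] * synthetic_div (newton_rem y f l) (y l)
        = [:- y l, 1:] * ((\<Prod>r\<in>{Suc l..<m}. [:- y r, 1:]) * h)" using eq by simp
    then have "synthetic_div (newton_rem y f l) (y l) = (\<Prod>r\<in>{Suc l..<m}. [:- y r, 1:]) * h"
      by (subst (asm) mult_cancel_left) simp
    then show ?case by simp
  qed
  from this[of l] assms(2) have "(\<Prod>r\<in>{l..<m}. [:- y r, 1:]) dvd newton_rem y f l" by simp
  moreover have "[:- y l, 1:] dvd (\<Prod>r\<in>{l..<m}. [:- y r, 1:])"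
    using assms(2) by (intro dvd_prodI) auto
  ultimately have "[:- y l, 1:] dvd newton_rem y f l" by (rule dvd_trans[rotated])
  then show ?thesis by (simp add: divided_diff_def poly_eq_0_iff_dvd)
qed

lemma polynomial_fun_const: "polynomial_fun m (\<lambda>x. c)"
  unfolding polynomial_fun_def
  by (rule exI[of _ "{\<lambda>_. 0}"], rule exI[of _ "\<lambda>_. c"]) simp

lemma polynomial_fun_coord:
  assumes "i < m" shows "polynomial_fun m (\<lambda>x. x i)"
proof -
  have "(\<Prod>r<m. x r ^ (if r = i then 1 else 0)) = x i" for x :: "nat \<Rightarrow> real"
    using assms prod.remove[of "{..<m}" i "\<lambda>r. x r ^ (if r = i then 1 else 0)"] by simp
  then show ?thesis unfolding polynomial_fun_def
    by (intro exI[of _ "{\<lambda>r. if r = i then 1 else 0}"] exI[of _ "\<lambda>_. 1"]) simp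
qed

lemma polynomial_fun_add:
  assumes "polynomial_fun m p" "polynomial_fun m q"
  shows "polynomial_fun m (\<lambda>x. p x + q x)"
proof -
  from assms obtain E c F b where E: "finite E" "p = (\<lambda>x. \<Sum>\<alpha>\<in>E. c \<alpha> * (\<Prod>i<m. x i ^ \<alpha> i))"
    and F: "finite F" "q = (\<lambda>x. \<Sum>\<alpha>\<in>F. b \<alpha> * (\<Prod>i<m. x i ^ \<alpha> i))"
    unfolding polynomial_fun_def by auto
  define c' where "c' \<alpha> = (if \<alpha> \<in> E then c \<alpha> else 0)" for \<alpha>
  define b' where "b' \<alpha> = (if \<alpha> \<in> F then b \<alpha> else 0)" for \<alpha>
  have "p x = (\<Sum>\<alpha>\<in>E \<union> F. c' \<alpha> * (\<Prod>i<m. x i ^ \<alpha> i))" for x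
    unfolding E(2) by (rule sum.mono_neutral_cong_left) (auto simp: E F c'_def)
  moreover have "q x = (\<Sum>\<alpha>\<in>E \<union> F. b' \<alpha> * (\<Prod>i<m. x i ^ \<alpha> i))" for x
    unfolding F(2) by (rule sum.mono_neutral_cong_left) (auto simp: E F b'_def)
  ultimately have "(\<lambda>x. p x + q x) = (\<lambda>x. \<Sum>\<alpha>\<in>E \<union> F. (c' \<alpha> + b' \<alpha>) * (\<Prod>i<m. x i ^ \<alpha> i))"
    by (simp add: distrib_right sum.distrib)
  then show ?thesis unfolding polynomial_fun_def
    by (intro exI[of _ "E \<union> F"] exI[of _ "\<lambda>\<alpha>. c' \<alpha> + b' \<alpha>"] conjI finite_UnI E(1) F(1))
qed

lemma polynomial_fun_mult:
  assumes "polynomial_fun m p" "polynomial_fun m q"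
  shows "polynomial_fun m (\<lambda>x. p x * q x)"
proof -
  from assms obtain E c F b where E: "finite E" "p = (\<lambda>x. \<Sum>\<alpha>\<in>E. c \<alpha> * (\<Prod>i<m. x i ^ \<alpha> i))"
    and F: "finite F" "q = (\<lambda>x. \<Sum>\<alpha>\<in>F. b \<alpha> * (\<Prod>i<m. x i ^ \<alpha> i))"
    unfolding polynomial_fun_def by auto
  define g :: "(nat \<Rightarrow> nat) \<times> (nat \<Rightarrow> nat) \<Rightarrow> nat \<Rightarrow> nat" where "g = (\<lambda>(\<alpha>, \<beta>) i. \<alpha> i + \<beta> i)"
  define w where "w \<gamma> = (\<Sum>u\<in>{u \<in> E \<times> F. g u = \<gamma>}. c (fst u) * b (snd u))" for \<gamma>
  have fin: "finite (E \<times> F)" using E F by simp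
  have "p x * q x = (\<Sum>\<gamma>\<in>g ` (E \<times> F). w \<gamma> * (\<Prod>i<m. x i ^ \<gamma> i))" for x
  proof -
    have "p x * q x = (\<Sum>u\<in>E \<times> F. c (fst u) * b (snd u) * (\<Prod>i<m. x i ^ g u i))"
      unfolding E(2) F(2) sum_product sum.cartesian_product
      by (intro sum.cong) (auto simp: g_def power_add prod.distrib)
    also have "\<dots> = (\<Sum>\<gamma>\<in>g ` (E \<times> F). \<Sum>u\<in>{u \<in> E \<times> F. g u = \<gamma>}.
        c (fst u) * b (snd u) * (\<Prod>i<m. x i ^ g u i))"
      by (rule sum.image_gen[OF fin])
    also have "\<dots> = (\<Sum>\<gamma>\<in>g ` (E \<times> F). w \<gamma> * (\<Prod>i<m. x i ^ \<gamma> i))"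
      unfolding w_def sum_distrib_right by (intro sum.cong) auto
    finally show ?thesis .
  qed
  then have "(\<lambda>x. p x * q x) = (\<lambda>x. \<Sum>\<gamma>\<in>g ` (E \<times> F). w \<gamma> * (\<Prod>i<m. x i ^ \<gamma> i))" by (rule ext)
  then show ?thesis unfolding polynomial_fun_def
    by (intro exI[of _ "g ` (E \<times> F)"] exI[of _ w] conjI finite_imageI fin)
qed

lemma polynomial_fun_sum:
  assumes "\<And>u. u \<in> S \<Longrightarrow> polynomial_fun m (p u)"
  shows "polynomial_fun m (\<lambda>x. \<Sum>u\<in>S. p u x)"
  using assms
proof (induction S rule: infinite_finite_induct)
  case (insert u S)
  then have "polynomial_fun m (\<lambda>x. p u x + (\<Sum>u\<in>S. p u x))"
    by (intro polynomial_fun_add) auto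
  with insert show ?case by simp
qed (simp_all add: polynomial_fun_const)

lemma polynomial_fun_prod:
  assumes "\<And>u. u \<in> S \<Longrightarrow> polynomial_fun m (p u)"
  shows "polynomial_fun m (\<lambda>x. \<Prod>u\<in>S. p u x)"
  using assms
proof (induction S rule: infinite_finite_induct)
  case (insert u S)
  then have "polynomial_fun m (\<lambda>x. p u x * (\<Prod>u\<in>S. p u x))"
    by (intro polynomial_fun_mult) auto
  with insert show ?case by simp
qed (simp_all add: polynomial_fun_const)

lemma polynomial_fun_det:
  assumes "\<And>i j. i < n \<Longrightarrow> j < n \<Longrightarrow> polynomial_fun m (\<lambda>x. h x i j)"
  shows "polynomial_fun m (\<lambda>x. Determinant.det (Matrix.mat n n (\<lambda>(i, j). h x i j)))"
proof -
  have eq: "Determinant.det (Matrix.mat n n (\<lambda>(i, j). h x i j))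
      = (\<Sum>p\<in>{p. p permutes {0..<n}}. signof p * (\<Prod>i = 0..<n. h x i (p i)))" for x
    unfolding det_def'[OF mat_carrier] by (intro sum.cong refl arg_cong2[where f = "(*)"] prod.cong) auto
  have "polynomial_fun m (\<lambda>x. \<Prod>i = 0..<n. h x i (p i))" if "p permutes {0..<n}" for p
    using permutes_in_image[OF that] by (intro polynomial_fun_prod assms) auto
  then have "polynomial_fun m (\<lambda>x. signof p * (\<Prod>i = 0..<n. h x i (p i)))"
    if "p permutes {0..<n}" for p
    using that by (intro polynomial_fun_mult polynomial_fun_const) auto
  then show ?thesis
    unfolding eq by (intro polynomial_fun_sum) simp
qed

lemma coeff_synthetic_div:
  fixes p :: "real poly"
  shows "coeff (synthetic_div p c) n = coeff p (Suc n) + c * coeff (synthetic_div p c) (Suc n)"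
  using arg_cong[OF synthetic_div_correct[of p c], of "\<lambda>q. coeff q (Suc n)"] by simp

lemma poly_via_synthetic_div:
  fixes p :: "real poly"
  shows "poly p c = coeff p 0 + c * coeff (synthetic_div p c) 0"
  using arg_cong[OF synthetic_div_correct[of p c], of "\<lambda>q. coeff q 0"] by simp

text \<open>The coefficients of the Horner quotient satisfy a recursion from the top degree downwards, which is
why a bound on the degree that is uniform in the parameter \<open>x\<close> is needed.\<close>

lemma polynomial_fun_synthetic_div:
  assumes P: "\<And>n. polynomial_fun m (\<lambda>x. coeff (P x) n)" and deg: "\<And>x. degree (P x) \<le> N"
    and c: "polynomial_fun m c"
  shows "polynomial_fun m (\<lambda>x. coeff (synthetic_div (P x) (c x)) n)"
proof (induction "N - n" arbitrary: n)
  case 0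
  then have "coeff (synthetic_div (P x) (c x)) n = coeff (P x) (Suc n)" for x
    using deg[of x] degree_synthetic_div[of "P x" "c x"]
    by (subst coeff_synthetic_div) (simp add: coeff_eq_0)
  then show ?case using P by simp
next
  case (Suc k)
  then have "polynomial_fun m (\<lambda>x. coeff (synthetic_div (P x) (c x)) (Suc n))" by simp
  then have "polynomial_fun m (\<lambda>x. coeff (P x) (Suc n)
      + c x * coeff (synthetic_div (P x) (c x)) (Suc n))"
    by (intro polynomial_fun_add polynomial_fun_mult P c)
  then show ?case by (simp only: coeff_synthetic_div[of _ _ n])
qed

lemma degree_newton_rem: "degree (newton_rem y f l) \<le> degree f"
  by (induction l) (simp_all add: degree_synthetic_div)

lemma polynomial_fun_divided_diff:
  assumes "l < m" shows "polynomial_fun m (\<lambda>x. divided_diff x f l)"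
proof -
  have coeffs: "polynomial_fun m (\<lambda>x. coeff (newton_rem x f l) n)" if "l \<le> m" for l n
    using that
  proof (induction l arbitrary: n)
    case (Suc l)
    then show ?case
      using polynomial_fun_synthetic_div[of m "\<lambda>x. newton_rem x f l" "degree f" "\<lambda>x. x l" n]
      by (simp add: degree_newton_rem polynomial_fun_coord)
  qed (simp add: polynomial_fun_const)
  have "polynomial_fun m (\<lambda>x. coeff (newton_rem x f l) 0
      + x l * coeff (newton_rem x f (Suc l)) 0)"
    using assms by (intro polynomial_fun_add polynomial_fun_mult coeffs polynomial_fun_coord) auto
  then show ?thesis by (simp add: divided_diff_def poly_via_synthetic_div)
qed

text \<open>By Newton's formula the matrix of values at the nodes is a lower triangular matrix, with the
products of differences of nodes on the diagonal, times the matrix of divided differences.\<close>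

lemma det_monomials_factor:
  fixes x :: "nat \<Rightarrow> real"
  shows "Determinant.det (Matrix.mat m m (\<lambda>(i, j). x i ^ e j)) = (\<Prod>j<m. \<Prod>i<j. x j - x i)
     * Determinant.det (Matrix.mat m m (\<lambda>(i, j). divided_diff x (Polynomial.monom 1 (e j)) i))"
proof -
  define L where "L = Matrix.mat m m (\<lambda>(i, l). \<Prod>q<l. x i - x q)"
  define D where "D = Matrix.mat m m (\<lambda>(i, j). divided_diff x (Polynomial.monom 1 (e j)) i)"
  have LD: "L \<in> carrier_mat m m" "D \<in> carrier_mat m m" by (auto simp: L_def D_def)
  have pw: "x i ^ e j = (\<Sum>l<m. (\<Prod>q<l. x i - x q) * divided_diff x (Polynomial.monom 1 (e j)) l)"
    if "i < m" for i j
  proof -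
    have "x i ^ e j = poly (Polynomial.monom 1 (e j)) (x i)" by (simp add: poly_monom)
    also have "\<dots> = (\<Sum>l<m. divided_diff x (Polynomial.monom 1 (e j)) l * poly (node_poly x l) (x i))
        + poly (node_poly x m) (x i) * poly (newton_rem x (Polynomial.monom 1 (e j)) m) (x i)"
      by (subst newton_form[of _ x m]) (simp add: poly_sum)
    also have "poly (node_poly x m) (x i) = 0"
      using that by (auto simp: node_poly_def poly_prod prod_zero_iff)
    finally show ?thesis by (simp add: node_poly_def poly_prod mult.commute)
  qed
  have "Matrix.mat m m (\<lambda>(i, j). x i ^ e j) = L * D"
    by (rule eq_matI) (auto simp: L_def D_def scalar_prod_def pw atLeast0LessThan)
  then have "Determinant.det (Matrix.mat m m (\<lambda>(i, j). x i ^ e j)) = Determinant.det L * Determinant.det D"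
    using det_mult[OF LD] by simp
  also have "Determinant.det L = (\<Prod>j<m. \<Prod>i<j. x j - x i)"
  proof -
    have "L $$ (i, j) = 0" if "i < j" "j < m" for i j
      using that by (auto simp: L_def prod_zero_iff)
    then have "Determinant.det L = prod_list (diag_mat L)"
      using det_lower_triangular[OF _ LD(1)] by blast
    also have "\<dots> = (\<Prod>j<m. \<Prod>i<j. x j - x i)"
      unfolding prod_list_diag_prod by (auto simp: L_def atLeast0LessThan intro!: prod.cong)
    finally show ?thesis .
  qed
  finally show ?thesis by (simp add: D_def)
qed

text \<open>The Vandermonde product may be cancelled: the set where it does not vanish is dense, and polynomial
functions are continuous.\<close>

lemma polynomial_fun_eqI:
  assumes p: "polynomial_fun m p" and q: "polynomial_fun m q"
    and eq: "\<And>x. (\<Prod>j<m. \<Prod>i<j. x j - x i) * p x = (\<Prod>j<m. \<Prod>i<j. x j - x i) * q x"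
  shows "p = q"
proof
  fix x :: "nat \<Rightarrow> real"
  \<comment> \<open>On this line through \<open>x\<close> all coordinates are distinct for all but finitely many \<open>t\<close>.\<close>
  define u where "u t i = x i + t * real i" for t i
  have cont: "((\<lambda>t. f (u t)) \<longlongrightarrow> f (u 0)) (at 0)" if "polynomial_fun m f" for f
  proof -
    from that obtain E c where "f = (\<lambda>x. \<Sum>\<alpha>\<in>E. c \<alpha> * (\<Prod>i<m. x i ^ \<alpha> i))"
      unfolding polynomial_fun_def by auto
    then have "isCont (\<lambda>t. f (u t)) 0" unfolding u_def by (auto intro!: continuous_intros)
    then show ?thesis by (simp add: isCont_def)
  qed
  define F where "F = (\<lambda>(i, j). (x i - x j) / (real j - real i)) ` ({..<m} \<times> {..<m})"
  have "finite F" by (simp add: F_def)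
  then have "eventually (\<lambda>t. t \<notin> F) (at 0)"
    using islimpt_finite[of F 0] by (simp add: islimpt_iff_eventually)
  then have "eventually (\<lambda>t. p (u t) = q (u t)) (at 0)"
  proof eventually_elim
    case (elim t)
    have "u t j - u t i \<noteq> 0" if "j < m" "i < j" for i j
    proof
      assume "u t j - u t i = 0"
      then have "t * (real j - real i) = x i - x j" by (simp add: u_def algebra_simps)
      then have "t = (x i - x j) / (real j - real i)" using that by (simp add: field_simps)
      then have "t \<in> F" using that unfolding F_def by force
      with elim show False by simp
    qed
    then have "(\<Prod>j<m. \<Prod>i<j. u t j - u t i) \<noteq> 0" by (auto simp: prod_zero_iff)
    then show ?case using eq[of "u t"] by simp
  qed
  then have "((\<lambda>t. p (u t)) \<longlongrightarrow> q (u 0)) (at 0)"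
    using cont[OF q] by (simp add: tendsto_cong)
  then have "p (u 0) = q (u 0)" using cont[OF p] tendsto_unique by (metis at_neq_bot)
  moreover have "u 0 = x" by (simp add: u_def fun_eq_iff)
  ultimately show "p x = q x" by simp
qed

text \<open>This settles existence and uniqueness in the definition of the Schur-type polynomial and makes its
values at repeated arguments accessible.\<close>

lemma schur_poly_eq_det:
  assumes "e 0 = 0"
  shows "schur_poly m e x
     = Determinant.det (Matrix.mat m m (\<lambda>(i, j). divided_diff x (Polynomial.monom 1 (e j)) i))"
proof -
  define p where "p x = Determinant.det
    (Matrix.mat m m (\<lambda>(i, j). divided_diff x (Polynomial.monom 1 (e j)) i))" for x
  have p: "polynomial_fun m p"
    unfolding p_def by (intro polynomial_fun_det polynomial_fun_divided_diff)
  have "schur_poly m e = p" unfolding schur_poly_def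
  proof (rule the_equality)
    show "polynomial_fun m p \<and> (\<forall>x. Determinant.det (Matrix.mat m m (\<lambda>(i, j). x i ^ e j)) =
          (\<Prod>i<m. x i) ^ e 0 * (\<Prod>j<m. \<Prod>i<j. x j - x i) * p x)"
      using p by (simp add: assms p_def det_monomials_factor)
  next
    fix q assume q: "polynomial_fun m q \<and> (\<forall>x. Determinant.det (Matrix.mat m m (\<lambda>(i, j). x i ^ e j)) =
          (\<Prod>i<m. x i) ^ e 0 * (\<Prod>j<m. \<Prod>i<j. x j - x i) * q x)"
    show "q = p"
    proof (rule polynomial_fun_eqI)
      fix x :: "nat \<Rightarrow> real"
      have "(\<Prod>j<m. \<Prod>i<j. x j - x i) * q x = Determinant.det (Matrix.mat m m (\<lambda>(i, j). x i ^ e j))"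
        using q by (simp add: assms)
      then show "(\<Prod>j<m. \<Prod>i<j. x j - x i) * q x = (\<Prod>j<m. \<Prod>i<j. x j - x i) * p x"
        by (simp add: p_def det_monomials_factor)
    qed (use q p in auto)
  qed
  then show ?thesis by (simp add: p_def)
qed

section \<open>Hermite unisolvence\<close>

definition span_poly :: "nat \<Rightarrow> (nat \<Rightarrow> nat) \<Rightarrow> (nat \<Rightarrow> real) \<Rightarrow> real poly" where
  "span_poly m e a = (\<Sum>j<m. Polynomial.smult (a j) (Polynomial.monom 1 (e j)))"

lemma poly_span_poly: "poly (span_poly m e a) x = (\<Sum>j<m. a j * x ^ e j)"
  by (simp add: span_poly_def poly_sum poly_monom)

lemma divided_diff_span_poly:
  "divided_diff y (span_poly m e a) l = (\<Sum>j<m. divided_diff y (Polynomial.monom 1 (e j)) l * a j)"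
  unfolding span_poly_def by (rule divided_diff_sum) simp

text \<open>The divided differences of a combination of monomials are obtained from its coefficients by the
matrix whose determinant is the Schur-type polynomial.\<close>

lemma span_poly_eq_0_if_nodes_dvd:
  assumes "e 0 = 0" and nz: "schur_poly m e y \<noteq> 0"
    and dvd: "node_poly y m dvd span_poly m e a" and "j < m"
  shows "a j = 0"
proof -
  define D where "D = Matrix.mat m m (\<lambda>(i, j). divided_diff y (Polynomial.monom 1 (e j)) i)"
  have D: "D \<in> carrier_mat m m" by (simp add: D_def)
  have "D *\<^sub>v Matrix.vec m a = 0\<^sub>v m"
  proof (rule eq_vecI)
    fix i assume "i < dim_vec (0\<^sub>v m :: real Matrix.vec)"
    then have i: "i < m" by simp
    then have "(D *\<^sub>v Matrix.vec m a) $ i = divided_diff y (span_poly m e a) i"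
      by (simp add: D_def scalar_prod_def divided_diff_span_poly atLeast0LessThan)
    then show "(D *\<^sub>v Matrix.vec m a) $ i = 0\<^sub>v m $ i"
      using divided_diff_eq_0_if_dvd[OF dvd i] i by simp
  qed (simp add: D_def)
  moreover have "Determinant.det D \<noteq> 0"
    using nz schur_poly_eq_det[of e m y, OF assms(1)] by (simp add: D_def)
  ultimately have "Matrix.vec m a = 0\<^sub>v m"
    using det_0_iff_vec_prod_zero_field[OF D] vec_carrier by blast
  then show ?thesis using \<open>j < m\<close> by (metis index_vec index_zero_vec(1))
qed

text \<open>Invertibility of the same matrix: the first \<open>m\<close> divided differences of \<open>f\<close> can be prescribed, and
by Newton's formula they determine a polynomial modulo the node polynomial.\<close>

lemma span_poly_interpolates_mod_nodes:
  assumes "e 0 = 0" and nz: "schur_poly m e y \<noteq> 0"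
  shows "\<exists>a. node_poly y m dvd span_poly m e a - f"
proof -
  define D where "D = Matrix.mat m m (\<lambda>(i, j). divided_diff y (Polynomial.monom 1 (e j)) i)"
  have D: "D \<in> carrier_mat m m" by (simp add: D_def)
  have det: "Determinant.det D \<noteq> 0"
    using nz schur_poly_eq_det[of e m y, OF assms(1)] by (simp add: D_def)
  define b where "b = Matrix.vec m (divided_diff y f)"
  define u where "u = (1 / Determinant.det D) \<cdot>\<^sub>v (adj_mat D *\<^sub>v b)"
  have b: "b \<in> carrier_vec m" by (simp add: b_def)
  have u: "u \<in> carrier_vec m" using adj_mat(1)[OF D] by (simp add: u_def b_def)
  have "D *\<^sub>v u = (1 / Determinant.det D) \<cdot>\<^sub>v (D *\<^sub>v (adj_mat D *\<^sub>v b))"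
    unfolding u_def by (rule mult_mat_vec[OF D]) (use adj_mat(1)[OF D] b in auto)
  also have "D *\<^sub>v (adj_mat D *\<^sub>v b) = (D * adj_mat D) *\<^sub>v b"
    by (rule assoc_mult_mat_vec[symmetric, OF D adj_mat(1)[OF D] b])
  also have "\<dots> = Determinant.det D \<cdot>\<^sub>v b"
    unfolding adj_mat(2)[OF D] using b
    by (intro eq_vecI) (auto simp: scalar_prod_def mult_delta_left mult_delta_right)
  finally have Du: "D *\<^sub>v u = b" using det b by (simp add: smult_smult_assoc)
  have dd: "divided_diff y (span_poly m e (($) u)) l = divided_diff y f l" if "l < m" for l
  proof -
    have "(D *\<^sub>v u) $ l = divided_diff y (span_poly m e (($) u)) l"
      using that u by (simp add: D_def scalar_prod_def divided_diff_span_poly atLeast0LessThan)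
    then show ?thesis using Du that by (simp add: b_def)
  qed
  let ?s = "span_poly m e (($) u)"
  let ?S = "\<Sum>r<m. Polynomial.smult (divided_diff y f r) (node_poly y r)"
  have "(\<Sum>r<m. Polynomial.smult (divided_diff y ?s r) (node_poly y r)) = ?S"
    using dd by (intro sum.cong) auto
  then have "?s = ?S + node_poly y m * newton_rem y ?s m"
    by (intro trans[OF newton_form[of ?s y m]] arg_cong2[where f = "(+)"] refl)
  moreover have "f = ?S + node_poly y m * newton_rem y f m" by (rule newton_form)
  ultimately have "?s - f = (?S + node_poly y m * newton_rem y ?s m) - (?S + node_poly y m * newton_rem y f m)"
    by (rule arg_cong2[where f = "(-)"])
  also have "\<dots> = node_poly y m * newton_rem y ?s m - node_poly y m * newton_rem y f m"
    by (rule add_diff_cancel_left)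
  also have "\<dots> = node_poly y m * (newton_rem y ?s m - newton_rem y f m)"
    by (simp add: right_diff_distrib)
  finally show ?thesis by (metis dvd_triv_left)
qed

lemma node_poly_doubled:
  "node_poly (\<lambda>l. x (l div 2)) (2 * k) = (\<Prod>i<k. [:- x i, 1:] ^ 2)"
proof (induction k)
  case (Suc k)
  have "2 * Suc k = Suc (Suc (2 * k))" by simp
  then have "node_poly (\<lambda>l. x (l div 2)) (2 * Suc k)
      = node_poly (\<lambda>l. x (l div 2)) (2 * k) * [:- x k, 1:] * [:- x k, 1:]"
    unfolding node_poly_def by (simp only: prod.lessThan_Suc) simp
  then show ?case by (simp only: Suc prod.lessThan_Suc power2_eq_square mult.assoc)
qed (simp add: node_poly_def)

text \<open>Skipping position \<open>2 * i + 1\<close> in the list of doubled nodes leaves the list in which only the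
\<open>i\<close>-th node is simple.\<close>

lemma node_poly_doubled_but_one:
  assumes "i < k"
  shows "node_poly (\<lambda>l. if l \<le> 2 * i then x (l div 2) else x ((l + 1) div 2)) (2 * k - 1) * [:- x i, 1:]
     = (\<Prod>i<k. [:- x i, 1:] ^ 2)"
proof -
  define g where "g l = (if l \<le> 2 * i then l else l + 1)" for l
  have "bij_betw g {..<2 * k - 1} ({..<2 * k} - {2 * i + 1})"
    unfolding bij_betw_def
  proof
    show "inj_on g {..<2 * k - 1}" by (auto simp: inj_on_def g_def split: if_splits)
    show "g ` {..<2 * k - 1} = {..<2 * k} - {2 * i + 1}"
    proof (intro equalityI subsetI)
      fix l assume l: "l \<in> {..<2 * k} - {2 * i + 1}"
      have "l = g (if l \<le> 2 * i then l else l - 1)" using l by (auto simp: g_def)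
      moreover have "(if l \<le> 2 * i then l else l - 1) < 2 * k - 1" using l assms by auto
      ultimately show "l \<in> g ` {..<2 * k - 1}" by blast
    qed (use assms in \<open>auto simp: g_def split: if_splits\<close>)
  qed
  then have "(\<Prod>l\<in>{..<2 * k} - {2 * i + 1}. [:- x (l div 2), 1:])
      = (\<Prod>l<2 * k - 1. [:- x (g l div 2), 1:])"
    by (rule prod.reindex_bij_betw[symmetric])
  also have "\<dots> = node_poly (\<lambda>l. if l \<le> 2 * i then x (l div 2) else x ((l + 1) div 2)) (2 * k - 1)"
    unfolding node_poly_def by (intro prod.cong) (auto simp: g_def)
  finally have "node_poly (\<lambda>l. if l \<le> 2 * i then x (l div 2) else x ((l + 1) div 2)) (2 * k - 1)
      * [:- x i, 1:] = [:- x ((2 * i + 1) div 2), 1:] * (\<Prod>l\<in>{..<2 * k} - {2 * i + 1}. [:- x (l div 2), 1:])"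
    by (simp only: mult.commute) simp
  also have "\<dots> = node_poly (\<lambda>l. x (l div 2)) (2 * k)"
    unfolding node_poly_def using assms by (intro prod.remove[symmetric]) auto
  finally show ?thesis by (simp only: node_poly_doubled)
qed

text \<open>For distinct points the hypothesis on the zero set provides a list of nodes, each point occurring
once or twice, at which the Schur-type polynomial does not vanish. For odd \<open>m\<close> the hypothesis
does not tell which of the points is the simple one, so the conclusion is phrased by divisibility.\<close>

lemma exists_nodes_with_schur_poly_nonzero:
  assumes k: "k = nat \<lceil>real m / 2\<rceil>"
    and Z: "\<And>x. x \<in> schur_zeros m e \<Longrightarrow> \<exists>i<k. \<exists>j<k. i \<noteq> j \<and> x i = x j"
    and inj: "inj_on x {..<k}"
  obtains y where "schur_poly m e y \<noteq> 0" "node_poly y m dvd (\<Prod>i<k. [:- x i, 1:] ^ 2)"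
    "(\<Prod>i<k. [:- x i, 1:]) dvd node_poly y m"
proof -
  have nz: "x \<notin> schur_zeros m e" using Z inj by (force simp: inj_on_def)
  show thesis
  proof (cases "even m")
    case True
    then have m: "m = 2 * k" using k by (auto elim!: evenE)
    then have "schur_poly m e (\<lambda>l. x (l div 2)) \<noteq> 0"
      using nz True k by (simp add: schur_zeros_def schur_even_def Let_def)
    moreover have "(\<Prod>i<k. [:- x i, 1:] ^ 2) = (\<Prod>i<k. [:- x i, 1:]) * (\<Prod>i<k. [:- x i, 1:])"
      by (simp only: power2_eq_square prod.distrib)
    ultimately show thesis
      using that node_poly_doubled[of x k] m by (metis dvd_refl dvd_triv_left)
  next
    case False
    then obtain t where t: "m = 2 * t + 1" by (auto elim!: oddE)
    have "\<lceil>real m / 2\<rceil> = int t + 1" unfolding t by (simp add: ceiling_eq_iff field_simps)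
    then have m: "m = 2 * k - 1" using k t by simp
    obtain i where i: "i < k" "schur_odd k e i x \<noteq> 0"
      using nz False k by (auto simp: schur_zeros_def Let_def)
    define y where "y l = (if l \<le> 2 * i then x (l div 2) else x ((l + 1) div 2))" for l
    have eq: "node_poly y m * [:- x i, 1:] = (\<Prod>i<k. [:- x i, 1:] ^ 2)"
      unfolding y_def m by (rule node_poly_doubled_but_one[OF i(1)])
    have "\<dots> = (\<Prod>i<k. [:- x i, 1:]) * ((\<Prod>r\<in>{..<k} - {i}. [:- x r, 1:]) * [:- x i, 1:])"
      using i(1) prod.remove[of "{..<k}" i "\<lambda>i. [:- x i, 1:]"]
      by (simp only: power2_eq_square prod.distrib mult.commute finite_lessThan lessThan_iff)
    then have "node_poly y m * [:- x i, 1:]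
        = ((\<Prod>i<k. [:- x i, 1:]) * (\<Prod>r\<in>{..<k} - {i}. [:- x r, 1:])) * [:- x i, 1:]"
      by (simp only: eq mult.assoc)
    then have "node_poly y m = (\<Prod>i<k. [:- x i, 1:]) * (\<Prod>r\<in>{..<k} - {i}. [:- x r, 1:])"
      by (subst (asm) mult_right_cancel) auto
    moreover have "schur_poly m e y \<noteq> 0" using i(2) by (simp add: schur_odd_def y_def[abs_def] m)
    ultimately show thesis using that eq by (metis dvd_triv_left)
  qed
qed

text \<open>Squares of linear factors with distinct roots are coprime.\<close>

lemma prod_squares_dvd:
  fixes f :: "real poly"
  assumes "finite X" "\<And>x. x \<in> X \<Longrightarrow> [:- x, 1:] ^ 2 dvd f"
  shows "(\<Prod>x\<in>X. [:- x, 1:] ^ 2) dvd f"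
proof (cases "f = 0")
  case False
  from assms show ?thesis
  proof (induction X rule: finite_induct)
    case (insert x X)
    then obtain h where h: "f = (\<Prod>x\<in>X. [:- x, 1:] ^ 2) * h" by auto
    have "poly (\<Prod>x\<in>X. [:- x, 1:] ^ 2) x \<noteq> 0"
      using insert.hyps by (auto simp: poly_prod prod_zero_iff)
    then have "Polynomial.order x (\<Prod>x\<in>X. [:- x, 1:] ^ 2) = 0" by (rule order_0I)
    moreover have "2 \<le> Polynomial.order x f" using insert.prems[of x] order_divides False by blast
    moreover have "Polynomial.order x f = Polynomial.order x (\<Prod>x\<in>X. [:- x, 1:] ^ 2) + Polynomial.order x h"
      using False unfolding h by (rule order_mult)
    ultimately have "[:- x, 1:] ^ 2 dvd h" by (simp only: order_divides) simp
    then have "[:- x, 1:] ^ 2 * (\<Prod>x\<in>X. [:- x, 1:] ^ 2) dvd f"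
      unfolding h by (subst mult.commute) (rule mult_dvd_mono[OF dvd_refl])
    then show ?case by (simp only: prod.insert[OF insert.hyps])
  qed simp
qed simp

lemma lagrange_interpolation_exists:
  assumes "finite X" shows "\<exists>f :: real poly. \<forall>x\<in>X. poly f x = v x"
  using assms
proof (induction X rule: finite_induct)
  case (insert z X)
  then obtain f where f: "\<forall>x\<in>X. poly f x = v x" by blast
  define P where "P = (\<Prod>w\<in>X. [:- w, 1:])"
  have "poly P z \<noteq> 0" using insert.hyps by (auto simp: P_def poly_prod prod_zero_iff)
  moreover have "poly P x = 0" if "x \<in> X" for x
    using that insert.hyps by (auto simp: P_def poly_prod prod_zero_iff)
  ultimately have "\<forall>x\<in>insert z X. poly (f + Polynomial.smult ((v z - poly f z) / poly P z) P) x = v x"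
    using f by simp
  then show ?case by blast
qed simp

text \<open>Double zeros and values are treated asymmetrically on purpose: for \<open>m = 2 k - 1\<close> there are \<open>2 k\<close>
Hermite data for only \<open>m\<close> coefficients, so values and derivatives cannot be prescribed together.\<close>

definition hermite_unisolvent :: "nat \<Rightarrow> (nat \<Rightarrow> nat) \<Rightarrow> nat \<Rightarrow> bool" where
  "hermite_unisolvent m e k \<longleftrightarrow> (\<forall>X. finite X \<and> card X = k \<longrightarrow>
     (\<forall>a. (\<forall>x\<in>X. [:- x, 1:] ^ 2 dvd span_poly m e a) \<longrightarrow> (\<forall>j<m. a j = 0)) \<and>
     (\<forall>v. \<exists>a. \<forall>x\<in>X. poly (span_poly m e a) x = v x))"

lemma hermite_unisolvent_if_schur_zeros:
  assumes k: "k = nat \<lceil>real m / 2\<rceil>" and e0: "e 0 = 0"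
    and Z: "\<And>x. x \<in> schur_zeros m e \<Longrightarrow> \<exists>i<k. \<exists>j<k. i \<noteq> j \<and> x i = x j"
  shows "hermite_unisolvent m e k"
  unfolding hermite_unisolvent_def
proof (intro allI impI)
  fix X :: "real set" assume X: "finite X \<and> card X = k"
  then obtain x where x: "bij_betw x {..<k} X"
    using ex_bij_betw_nat_finite atLeast0LessThan by metis
  then have inj: "inj_on x {..<k}" and im: "x ` {..<k} = X" by (auto simp: bij_betw_def)
  obtain y where y: "schur_poly m e y \<noteq> 0" "node_poly y m dvd (\<Prod>i<k. [:- x i, 1:] ^ 2)"
    "(\<Prod>i<k. [:- x i, 1:]) dvd node_poly y m"
    using exists_nodes_with_schur_poly_nonzero[OF k Z inj] by blast
  have sq: "(\<Prod>i<k. [:- x i, 1:] ^ 2) = (\<Prod>x\<in>X. [:- x, 1:] ^ 2)"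
    using prod.reindex_bij_betw[OF x, of "\<lambda>x. [:- x, 1:] ^ 2"] by simp
  show "(\<forall>a. (\<forall>x\<in>X. [:- x, 1:] ^ 2 dvd span_poly m e a) \<longrightarrow> (\<forall>j<m. a j = 0)) \<and>
     (\<forall>v. \<exists>a. \<forall>x\<in>X. poly (span_poly m e a) x = v x)"
  proof (intro conjI allI impI)
    fix a j assume "\<forall>x\<in>X. [:- x, 1:] ^ 2 dvd span_poly m e a" and "j < m"
    then have "(\<Prod>i<k. [:- x i, 1:] ^ 2) dvd span_poly m e a"
      unfolding sq using X by (intro prod_squares_dvd) auto
    then show "a j = 0"
      using span_poly_eq_0_if_nodes_dvd[OF e0 y(1) _ \<open>j < m\<close>] y(2) dvd_trans by blast
  next
    fix v :: "real \<Rightarrow> real"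
    obtain f where f: "\<forall>x\<in>X. poly f x = v x" using X lagrange_interpolation_exists by blast
    obtain a where "node_poly y m dvd span_poly m e a - f"
      using span_poly_interpolates_mod_nodes[OF e0 y(1)] by blast
    with y(3) have dvd: "(\<Prod>i<k. [:- x i, 1:]) dvd span_poly m e a - f" by (rule dvd_trans)
    have "poly (span_poly m e a) u = v u" if "u \<in> X" for u
    proof -
      from that im obtain i where i: "i < k" "u = x i" by auto
      then have "[:- u, 1:] dvd (\<Prod>i<k. [:- x i, 1:])" by (auto intro!: dvd_prodI)
      then have "[:- u, 1:] dvd span_poly m e a - f" using dvd by (rule dvd_trans)
      then have "poly (span_poly m e a - f) u = 0" by (simp only: poly_eq_0_iff_dvd)
      then show ?thesis using f that by simp
    qed
    then show "\<exists>a. \<forall>x\<in>X. poly (span_poly m e a) x = v x" by blast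
  qed
qed

lemma square_dvd_if_double_root:
  fixes p :: "real poly"
  assumes "poly p x = 0" "poly (pderiv p) x = 0"
  shows "[:- x, 1:] ^ 2 dvd p"
proof -
  from assms(1) obtain q where q: "p = [:- x, 1:] * q" by (metis dvdE poly_eq_0_iff_dvd)
  have "poly (pderiv p) x = poly q x" unfolding q by (simp only: pderiv_mult) (simp add: pderiv_pCons)
  then obtain r where "q = [:- x, 1:] * r" using assms(2) by (metis dvdE poly_eq_0_iff_dvd)
  then have "p = [:- x, 1:] ^ 2 * r" unfolding q by (simp only: power2_eq_square mult.assoc)
  then show ?thesis by (rule dvdI)
qed

lemma poly_pderiv_span_poly:
  "poly (pderiv (span_poly m e a)) x = (\<Sum>j<m. real (e j) * x ^ (e j - 1) * a j)"
proof -
  have "pderiv (span_poly m e a) = (\<Sum>j<m. pderiv (Polynomial.smult (a j) (Polynomial.monom 1 (e j))))"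
    unfolding span_poly_def by (induction m) (simp_all add: pderiv_add)
  then show ?thesis by (simp add: pderiv_smult pderiv_monom poly_sum poly_monom mult_ac)
qed

lemma hermite_unisolventD:
  assumes "hermite_unisolvent m e k" "finite X" "card X = k"
    "\<And>x. x \<in> X \<Longrightarrow> poly (span_poly m e a) x = 0"
    "\<And>x. x \<in> X \<Longrightarrow> poly (pderiv (span_poly m e a)) x = 0"
    "j < m"
  shows "a j = 0"
proof -
  have "\<forall>x\<in>X. [:- x, 1:] ^ 2 dvd span_poly m e a"
    using assms(4,5) by (intro ballI square_dvd_if_double_root) auto
  then show ?thesis using assms(1-3,6) by (simp add: hermite_unisolvent_def)
qed

section \<open>Rank and annihilators\<close>

text \<open>Fewer equations than unknowns: the system is padded with zero rows to a square one, whose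
transpose kills a unit vector.\<close>

lemma exists_orthogonal:
  fixes w :: "nat \<Rightarrow> nat \<Rightarrow> real"
  assumes "n < m"
  obtains a where "\<exists>j<m. a j \<noteq> 0" "\<And>i. i < n \<Longrightarrow> (\<Sum>j<m. w i j * a j) = 0"
proof -
  define A where "A = Matrix.mat m m (\<lambda>(i, j). if i < n then w i j else 0)"
  have A: "A \<in> carrier_mat m m" by (simp add: A_def)
  have "A\<^sup>T *\<^sub>v unit_vec m n = 0\<^sub>v m"
    using assms by (intro eq_vecI) (auto simp: A_def scalar_prod_def unit_vec_def)
  moreover have "unit_vec m n \<noteq> (0\<^sub>v m :: real Matrix.vec)" using assms by simp
  moreover have "A\<^sup>T \<in> carrier_mat m m" using A by simp
  ultimately have "Determinant.det (A\<^sup>T) = 0"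
    using det_0_iff_vec_prod_zero_field unit_vec_carrier by blast
  then have "Determinant.det A = 0" using det_transpose[OF A] by simp
  then obtain v where v: "v \<in> carrier_vec m" "v \<noteq> 0\<^sub>v m" "A *\<^sub>v v = 0\<^sub>v m"
    using det_0_iff_vec_prod_zero_field[OF A] by blast
  have "\<exists>j<m. v $ j \<noteq> 0"
  proof (rule ccontr)
    assume "\<not> (\<exists>j<m. v $ j \<noteq> 0)"
    then have "v = 0\<^sub>v m" using v(1) by (intro eq_vecI) auto
    with v(2) show False by simp
  qed
  moreover have "(\<Sum>j<m. w i j * v $ j) = 0" if "i < n" for i
  proof -
    have "(A *\<^sub>v v) $ i = (\<Sum>j<m. w i j * v $ j)"
      using that assms v(1) by (simp add: A_def scalar_prod_def atLeast0LessThan)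
    then show ?thesis using v(3) that assms by simp
  qed
  ultimately show thesis using that by blast
qed

text \<open>The rank is full exactly if the columns have trivial annihilator. A maximal independent subset of
the columns has the same annihilator as all columns; if it had fewer than \<open>m\<close> elements, then
\<open>exists_orthogonal\<close> would apply.\<close>

lemma rank_mat_of_cols_eq_iff:
  assumes vs: "set vs \<subseteq> carrier_vec m"
  shows "vec_space.rank m (mat_of_cols m vs :: real Matrix.mat) = m \<longleftrightarrow>
    (\<forall>a. (\<forall>v\<in>set vs. (\<Sum>j<m. v $ j * a j) = 0) \<longrightarrow> (\<forall>j<m. a j = 0))"
proof -
  interpret vec_space "TYPE(real)" m .
  let ?M = "mat_of_cols m vs :: real Matrix.mat"
  have M: "?M \<in> carrier_mat m (length vs)" by simp
  have cols: "set (cols ?M) = set vs" using vs by (subst cols_mat_of_cols) auto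
  obtain S where S: "finite S" "maximal S (\<lambda>T. T \<subseteq> set vs \<and> lin_indpt T)"
    using maximal_exists_superset[of "set vs" "\<lambda>T. T \<subseteq> set vs \<and> lin_indpt T" "{}"]
    by (auto simp: lin_dep_def)
  have rank: "rank ?M = card S" using rank_card_indpt[OF M] S(2) by (simp add: cols)
  have Svs: "S \<subseteq> set vs" "lin_indpt S" using S(2) by (auto simp: maximal_def)
  with vs have Sc: "S \<subseteq> carrier_vec m" by blast
  have vs_span: "v \<in> span S" if "v \<in> set vs" for v
  proof (cases "v \<in> S")
    case True
    then show ?thesis using in_own_span Sc by auto
  next
    case False
    have "\<not> lin_indpt (S \<union> {v})"
      using S(2) False that Svs(1) unfolding maximal_def by blast
    then show ?thesis using lin_dep_iff_in_span[OF _ Svs(2) _ False] Sc that vs by auto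
  qed
  have ann: "(\<Sum>j<m. v $ j * a j) = 0" if a: "\<forall>u\<in>S. (\<Sum>j<m. u $ j * a j) = 0" and v: "v \<in> span S"
    for a v
  proof -
    obtain c where c: "v = lincomb c S"
      using v finite_in_span[OF S(1)] Sc by auto
    have "(\<Sum>j<m. v $ j * a j) = (\<Sum>j<m. \<Sum>u\<in>S. c u * (u $ j * a j))"
      unfolding c by (intro sum.cong) (auto simp: lincomb_index[OF _ Sc] sum_distrib_right mult.assoc)
    also have "\<dots> = (\<Sum>u\<in>S. c u * (\<Sum>j<m. u $ j * a j))"
      by (subst sum.swap) (simp add: sum_distrib_left)
    also have "\<dots> = 0" using a by simp
    finally show ?thesis .
  qed
  show ?thesis
  proof
    assume "rank ?M = m"
    then have "basis S" using rank Sc Svs(2) S(1) dim_is_n by (intro dim_li_is_basis) auto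
    then have span: "span S = carrier_vec m" by (simp add: basis_def)
    show "\<forall>a. (\<forall>v\<in>set vs. (\<Sum>j<m. v $ j * a j) = 0) \<longrightarrow> (\<forall>j<m. a j = 0)"
    proof (intro allI impI)
      fix a j assume a: "\<forall>v\<in>set vs. (\<Sum>j<m. v $ j * a j) = 0" and "j < m"
      then have "(\<Sum>i<m. unit_vec m j $ i * a i) = 0"
        using ann[of a "unit_vec m j"] Svs(1) span by auto
      moreover have "unit_vec m j $ i * a i = (if i = j then a i else 0)" if "i < m" for i
        using that \<open>j < m\<close> by (simp add: index_unit_vec(1))
      ultimately have "(\<Sum>i<m. if i = j then a i else 0) = 0" by simp
      then show "a j = 0" using \<open>j < m\<close> by simp
    qed
  next
    assume *: "\<forall>a. (\<forall>v\<in>set vs. (\<Sum>j<m. v $ j * a j) = 0) \<longrightarrow> (\<forall>j<m. a j = 0)"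
    have "card S \<le> m" using li_le_dim(2)[OF fin_dim _ Svs(2)] Sc dim_is_n by simp
    moreover have "\<not> card S < m"
    proof
      assume lt: "card S < m"
      obtain g where g: "bij_betw g {..<card S} S"
        using ex_bij_betw_nat_finite[OF S(1)] atLeast0LessThan by metis
      obtain a where a: "\<exists>j<m. a j \<noteq> 0" "\<And>i. i < card S \<Longrightarrow> (\<Sum>j<m. g i $ j * a j) = 0"
        using exists_orthogonal[OF lt, of "\<lambda>i j. g i $ j"] by blast
      have "\<forall>u\<in>S. (\<Sum>j<m. u $ j * a j) = 0"
      proof
        fix u assume "u \<in> S"
        then obtain i where "i < card S" "u = g i" using bij_betw_imp_surj_on[OF g] by force
        then show "(\<Sum>j<m. u $ j * a j) = 0" using a(2) by simp
      qed
      then have "\<forall>v\<in>set vs. (\<Sum>j<m. v $ j * a j) = 0"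
        using ann[of a] vs_span by simp
      then have "\<forall>j<m. a j = 0" using *[rule_format, of a] by blast
      with a(1) show False by blast
    qed
    ultimately show "rank ?M = m" using rank by simp
  qed
qed

section \<open>The rank numbers\<close>

lemma set_Basis_list: "set (Basis_list :: 'a :: euclidean_space list) = Basis"
  unfolding Basis_list_def
  using someI_ex[of "\<lambda>bs. distinct bs \<and> set bs = (Basis :: 'a set)"] finite_distinct_list[OF finite_Basis]
  by blast

text \<open>The moment map is affine in each weight and depends on each point through one summand only, so the
columns at an atom are the vector of values and the weighted vectors of partial derivatives.\<close>

lemma moment_jacobian_full_rank_iff:
  fixes f :: "nat \<Rightarrow> 'a :: euclidean_space \<Rightarrow> real"
  assumes D: "\<And>j x b. j < m \<Longrightarrow> b \<in> Basis \<Longrightarrow>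
    ((\<lambda>t. f j (x + t *\<^sub>R b)) has_real_derivative D j x b) (at 0)"
  shows "vec_space.rank m (moment_jacobian m f k C X) = m \<longleftrightarrow>
    (\<forall>a. (\<forall>i<k. (\<Sum>j<m. f j (X i) * a j) = 0 \<and>
              (\<forall>b\<in>Basis. (\<Sum>j<m. C i * D j (X i) b * a j) = 0)) \<longrightarrow> (\<forall>j<m. a j = 0))"
proof -
  define rest where "rest j i = (\<Sum>i'\<in>{..<k} - {i}. C i' * f j (X i'))" for j i
  have dc: "deriv (\<lambda>t. moment_map f k (C(i := t)) X j) (C i) = f j (X i)" if "i < k" for i j
  proof -
    have "moment_map f k (C(i := t)) X j = t * f j (X i) + rest j i" for t
      unfolding moment_map_def rest_def using that
      by (subst sum.remove[of _ i]) (auto intro!: sum.cong)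
    moreover have "((\<lambda>t. t * f j (X i) + rest j i) has_real_derivative f j (X i)) (at (C i))"
      by (auto intro!: derivative_eq_intros)
    ultimately show ?thesis by (simp add: DERIV_imp_deriv)
  qed
  have dx: "deriv (\<lambda>t. moment_map f k C (X(i := X i + t *\<^sub>R b)) j) 0 = C i * D j (X i) b"
    if "i < k" "j < m" "b \<in> Basis" for i j b
  proof -
    have "moment_map f k C (X(i := X i + t *\<^sub>R b)) j = C i * f j (X i + t *\<^sub>R b) + rest j i" for t
      unfolding moment_map_def rest_def using that
      by (subst sum.remove[of _ i]) (auto intro!: sum.cong)
    moreover have "((\<lambda>t. C i * f j (X i + t *\<^sub>R b) + rest j i) has_real_derivative C i * D j (X i) b) (at 0)"
      using D[OF that(2,3), of "X i"] by (auto intro!: derivative_eq_intros)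
    ultimately show ?thesis by (simp add: DERIV_imp_deriv)
  qed
  define vc where "vc i = Matrix.vec m (\<lambda>j. deriv (\<lambda>t. moment_map f k (C(i := t)) X j) (C i))" for i
  define vx where "vx i b = Matrix.vec m (\<lambda>j. deriv (\<lambda>t. moment_map f k C (X(i := X i + t *\<^sub>R b)) j) 0)"
    for i b
  define vs where "vs = concat (map (\<lambda>i. vc i # map (vx i) Basis_list) [0..<k])"
  have J: "moment_jacobian m f k C X = mat_of_cols m vs"
    by (simp add: moment_jacobian_def vs_def vc_def vx_def[abs_def])
  have set_vs: "set vs = (\<Union>i<k. insert (vc i) (vx i ` Basis))"
    by (auto simp: vs_def set_Basis_list)
  have "set vs \<subseteq> carrier_vec m" by (auto simp: set_vs vc_def vx_def)
  moreover have "(\<forall>v\<in>set vs. (\<Sum>j<m. v $ j * a j) = 0) \<longleftrightarrow>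
    (\<forall>i<k. (\<Sum>j<m. f j (X i) * a j) = 0 \<and> (\<forall>b\<in>Basis. (\<Sum>j<m. C i * D j (X i) b * a j) = 0))" for a
  proof -
    have "(\<Sum>j<m. vc i $ j * a j) = (\<Sum>j<m. f j (X i) * a j)" if "i < k" for i
      using that by (intro sum.cong) (auto simp: vc_def dc)
    moreover have "(\<Sum>j<m. vx i b $ j * a j) = (\<Sum>j<m. C i * D j (X i) b * a j)"
      if "i < k" "b \<in> Basis" for i b
      using that by (intro sum.cong) (auto simp: vx_def dx)
    ultimately show ?thesis by (auto simp: set_vs)
  qed
  ultimately show ?thesis unfolding J by (subst rank_mat_of_cols_eq_iff) auto
qed

lemma rank_number_monomials:
  assumes U: "hermite_unisolvent m e k" and k: "2 * k \<le> m + 1"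
  shows "rank_number m (monomials e) = k"
proof -
  define D where "D j x b = real (e j) * x ^ (e j - 1)" for j and x b :: real
  have D: "((\<lambda>t. monomials e j (x + t *\<^sub>R b)) has_real_derivative D j x b) (at 0)"
    if "b \<in> Basis" for j and x b :: real
    using that unfolding monomials_def D_def by (auto intro!: derivative_eq_intros)
  have full: "vec_space.rank m (moment_jacobian m (monomials e) k' C X) = m \<longleftrightarrow>
    (\<forall>a. (\<forall>i<k'. (\<Sum>j<m. X i ^ e j * a j) = 0 \<and> (\<Sum>j<m. C i * D j (X i) 1 * a j) = 0) \<longrightarrow>
      (\<forall>j<m. a j = 0))" for k' C X
    by (subst moment_jacobian_full_rank_iff[OF D]) (simp_all add: monomials_def)
  show ?thesis unfolding rank_number_def
  proof (rule Least_equality)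
    show "\<exists>C X. (\<forall>i<k. 0 \<le> C i) \<and> vec_space.rank m (moment_jacobian m (monomials e) k C X) = m"
    proof (intro exI conjI)
      show "vec_space.rank m (moment_jacobian m (monomials e) k (\<lambda>_. 1) real) = m"
        unfolding full
      proof (intro allI impI)
        fix a j
        assume a: "\<forall>i<k. (\<Sum>j<m. real i ^ e j * a j) = 0 \<and> (\<Sum>j<m. 1 * D j (real i) 1 * a j) = 0"
          and "j < m"
        show "a j = 0"
        proof (rule hermite_unisolventD[OF U, of "real ` {..<k}"])
          show "card (real ` {..<k}) = k" by (simp add: card_image)
        qed (use a \<open>j < m\<close> in \<open>auto simp: poly_span_poly poly_pderiv_span_poly D_def mult.commute\<close>)
      qed
    qed auto
  next
    fix k' assume "\<exists>C X. (\<forall>i<k'. 0 \<le> C i) \<and> vec_space.rank m (moment_jacobian m (monomials e) k' C X) = m"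
    then obtain C X where *: "vec_space.rank m (moment_jacobian m (monomials e) k' C X) = m" by blast
    have "\<not> 2 * k' < m"
    proof
      assume lt: "2 * k' < m"
      obtain a where a: "\<exists>j<m. a j \<noteq> 0" "\<And>i. i < 2 * k' \<Longrightarrow>
          (\<Sum>j<m. (if even i then X (i div 2) ^ e j else C (i div 2) * D j (X (i div 2)) 1) * a j) = 0"
        using exists_orthogonal[OF lt, of "\<lambda>i j. if even i then X (i div 2) ^ e j else C (i div 2) * D j (X (i div 2)) 1"]
        by blast
      have "(\<Sum>j<m. X i ^ e j * a j) = 0 \<and> (\<Sum>j<m. C i * D j (X i) 1 * a j) = 0" if "i < k'" for i
        using a(2)[of "2 * i"] a(2)[of "2 * i + 1"] that by simp
      with * a(1) show False unfolding full by blast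
    qed
    then show "k \<le> k'" using k by linarith
  qed
qed

text \<open>The upper bound uses the points \<open>(x, 1)\<close>, where the columns for the weight and for the first
coordinate are those of the inhomogeneous family. For the lower bound it is enough to be orthogonal
to both partial derivatives at each point: orthogonality to the values follows by Euler's identity,
as \<open>n\<close> is positive when there are at least two monomials.\<close>

lemma rank_number_hom_monomials:
  assumes U: "hermite_unisolvent m e k" and k: "2 * k \<le> m + 1"
    and e: "\<And>j. j < m \<Longrightarrow> e j \<le> n" and n: "m \<ge> 2 \<Longrightarrow> n > 0"
  shows "rank_number m (hom_monomials n e) = k"
proof -
  define Dx where "Dx j p = real (e j) * fst p ^ (e j - 1) * snd p ^ (n - e j)" for j and p :: "real \<times> real"
  define Dy where "Dy j p = fst p ^ e j * (real (n - e j) * snd p ^ (n - e j - 1))" for j and p :: "real \<times> real"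
  define D where "D j p b = (if b = (1, 0) then Dx j p else Dy j p)" for j p and b :: "real \<times> real"
  have Basis: "(Basis :: (real \<times> real) set) = {(1, 0), (0, 1)}" by (auto simp: Basis_prod_def)
  have D: "((\<lambda>t. hom_monomials n e j (x + t *\<^sub>R b)) has_real_derivative D j x b) (at 0)"
    if "b \<in> Basis" for j x b
  proof -
    have pw: "((\<lambda>t. (q + t * u) ^ i) has_real_derivative real i * (u * q ^ (i - 1))) (at 0)"
      for q u :: real and i
    proof -
      have "((\<lambda>t. q + t * u) has_real_derivative u) (at 0)" by (auto intro!: derivative_eq_intros)
      from DERIV_power[OF this, of i] show ?thesis by simp
    qed
    have "((\<lambda>t. (fst x + t * u) ^ i * (snd x + t * v) ^ l) has_real_derivative
        (real i * (u * fst x ^ (i - 1))) * snd x ^ l + (real l * (v * snd x ^ (l - 1))) * fst x ^ i) (at 0)"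
      for u v i l
      by (rule DERIV_cong[OF DERIV_mult[OF pw[of "fst x" u i] pw[of "snd x" v l]]]) simp
    note deriv = this[of "fst b" "e j" "snd b" "n - e j"]
    have "D j x b = (real (e j) * (fst b * fst x ^ (e j - 1))) * snd x ^ (n - e j)
        + (real (n - e j) * (snd b * snd x ^ (n - e j - 1))) * fst x ^ e j"
      using that unfolding Basis by (auto simp: D_def Dx_def Dy_def)
    moreover have "hom_monomials n e j (x + t *\<^sub>R b)
        = (fst x + t * fst b) ^ e j * (snd x + t * snd b) ^ (n - e j)" for t
      by (simp add: hom_monomials_def case_prod_beta)
    ultimately show ?thesis using deriv by (simp only:)
  qed
  have full: "vec_space.rank m (moment_jacobian m (hom_monomials n e) k' C X) = m \<longleftrightarrow>
    (\<forall>a. (\<forall>i<k'. (\<Sum>j<m. hom_monomials n e j (X i) * a j) = 0 \<and> (\<Sum>j<m. C i * Dx j (X i) * a j) = 0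
      \<and> (\<Sum>j<m. C i * Dy j (X i) * a j) = 0) \<longrightarrow> (\<forall>j<m. a j = 0))" for k' C X
    by (subst moment_jacobian_full_rank_iff[OF D]) (simp_all add: Basis D_def)
  have euler: "real n * hom_monomials n e j p = fst p * Dx j p + snd p * Dy j p" if "j < m" for j p
  proof -
    have pw: "x * (real l * x ^ (l - 1)) = real l * x ^ l" for x :: real and l
      by (cases l) auto
    have "fst p * Dx j p + snd p * Dy j p = fst p * (real (e j) * fst p ^ (e j - 1)) * snd p ^ (n - e j)
        + fst p ^ e j * (snd p * (real (n - e j) * snd p ^ (n - e j - 1)))"
      by (simp add: Dx_def Dy_def mult_ac)
    also have "\<dots> = (real (e j) + real (n - e j)) * (fst p ^ e j * snd p ^ (n - e j))"
      unfolding pw by (simp add: algebra_simps)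
    also have "real (e j) + real (n - e j) = real n" using e[OF that] by simp
    finally show ?thesis by (simp add: hom_monomials_def case_prod_beta)
  qed
  show ?thesis unfolding rank_number_def
  proof (rule Least_equality)
    show "\<exists>C X. (\<forall>i<k. 0 \<le> C i) \<and> vec_space.rank m (moment_jacobian m (hom_monomials n e) k C X) = m"
    proof (intro exI conjI)
      show "vec_space.rank m (moment_jacobian m (hom_monomials n e) k (\<lambda>_. 1) (\<lambda>i. (real i, 1))) = m"
        unfolding full
      proof (intro allI impI)
        fix a j
        assume a: "\<forall>i<k. (\<Sum>j<m. hom_monomials n e j (real i, 1) * a j) = 0 \<and>
            (\<Sum>j<m. 1 * Dx j (real i, 1) * a j) = 0 \<and> (\<Sum>j<m. 1 * Dy j (real i, 1) * a j) = 0"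
          and "j < m"
        show "a j = 0"
        proof (rule hermite_unisolventD[OF U, of "real ` {..<k}"])
          show "card (real ` {..<k}) = k" by (simp add: card_image)
        qed (use a \<open>j < m\<close> in \<open>auto simp: poly_span_poly poly_pderiv_span_poly Dx_def hom_monomials_def mult.commute\<close>)
      qed
    qed auto
  next
    fix k' assume "\<exists>C X. (\<forall>i<k'. 0 \<le> C i) \<and> vec_space.rank m (moment_jacobian m (hom_monomials n e) k' C X) = m"
    then obtain C X where *: "vec_space.rank m (moment_jacobian m (hom_monomials n e) k' C X) = m" by blast
    have "\<not> 2 * k' < m"
    proof
      assume lt: "2 * k' < m"
      obtain a where a: "\<exists>j<m. a j \<noteq> 0" "\<And>i. i < 2 * k' \<Longrightarrow>
          (\<Sum>j<m. (if even i then Dx j (X (i div 2)) else Dy j (X (i div 2))) * a j) = 0"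
        using exists_orthogonal[OF lt, of "\<lambda>i j. if even i then Dx j (X (i div 2)) else Dy j (X (i div 2))"]
        by blast
      have "(\<Sum>j<m. hom_monomials n e j (X i) * a j) = 0 \<and> (\<Sum>j<m. C i * Dx j (X i) * a j) = 0
        \<and> (\<Sum>j<m. C i * Dy j (X i) * a j) = 0" if "i < k'" for i
      proof -
        have x: "(\<Sum>j<m. Dx j (X i) * a j) = 0" and y: "(\<Sum>j<m. Dy j (X i) * a j) = 0"
          using a(2)[of "2 * i"] a(2)[of "2 * i + 1"] that by simp_all
        have "real n * (\<Sum>j<m. hom_monomials n e j (X i) * a j)
            = (\<Sum>j<m. (fst (X i) * Dx j (X i) + snd (X i) * Dy j (X i)) * a j)"
          unfolding sum_distrib_left by (intro sum.cong) (auto simp: mult.assoc simp flip: euler)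
        also have "\<dots> = fst (X i) * (\<Sum>j<m. Dx j (X i) * a j) + snd (X i) * (\<Sum>j<m. Dy j (X i) * a j)"
          by (simp add: sum_distrib_left sum.distrib algebra_simps)
        finally have "real n * (\<Sum>j<m. hom_monomials n e j (X i) * a j) = 0" using x y by simp
        moreover have "n > 0" using n lt that by simp
        moreover have "(\<Sum>j<m. C i * g j * a j) = C i * (\<Sum>j<m. g j * a j)" for g
          by (simp add: sum_distrib_left mult.assoc)
        ultimately show ?thesis using x y by simp
      qed
      with * a(1) show False unfolding full by blast
    qed
    then show "k \<le> k'" using k by linarith
  qed
qed

section \<open>Non-negative sparse polynomials\<close>

text \<open>Coefficient vectors are functions on all natural numbers with the product topology; pinning the
irrelevant coordinates to zero makes bounded closed sets compact by Tychonoff's theorem.\<close>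

lemma compact_bounded_coefficients:
  fixes S :: "(nat \<Rightarrow> real) set"
  assumes "closed S" and S: "\<And>a. a \<in> S \<Longrightarrow> (\<forall>j<m. \<bar>a j\<bar> \<le> B) \<and> (\<forall>j\<ge>m. a j = 0)"
  shows "compact S"
proof -
  define I where "I j = (if j < m then {- B..B} else {0 :: real})" for j
  have "compactin (product_topology (\<lambda>_. euclidean) UNIV) (PiE UNIV I)"
    by (subst compactin_PiE) (auto simp: I_def)
  then have "compact (PiE UNIV I)" by (simp add: euclidean_product_topology)
  moreover have "S \<subseteq> PiE UNIV I" using S by (fastforce simp: I_def abs_le_iff)
  ultimately show ?thesis using \<open>closed S\<close> by (metis compact_Int_closed inf.absorb_iff2)
qed

lemma continuous_on_linear_functional:
  "continuous_on UNIV (\<lambda>a :: nat \<Rightarrow> real. \<Sum>j<m. a j * s j)"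
  by (intro continuous_intros continuous_on_product_coordinates)

locale sparse_monomials =
  fixes m d k :: nat and e :: "nat \<Rightarrow> nat"
  assumes m_pos: "m \<ge> 1" and strict: "strict_mono_on {..<m} e"
    and e_first: "e 0 = 0" and e_last: "e (m - 1) = 2 * d"
    and unisolvent: "hermite_unisolvent m e k"
begin

abbreviation pol :: "(nat \<Rightarrow> real) \<Rightarrow> real \<Rightarrow> real" where
  "pol a x \<equiv> poly (span_poly m e a) x"

text \<open>The coefficients of \<open>1 + x\<^sup>2\<^sup>d\<close>, which dominates every combination up to a constant factor. For
\<open>m = 1\<close> the two terms coincide and the value is the constant \<open>2\<close>.\<close>

definition order_unit_coeffs :: "nat \<Rightarrow> real" where
  "order_unit_coeffs j = (if j = 0 then 1 else 0) + (if j = m - 1 then 1 else 0)"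

lemma e_less: "j < m - 1 \<Longrightarrow> e j < 2 * d"
  using strict_mono_onD[OF strict, of j "m - 1"] e_last by auto

lemma e_le: "j < m \<Longrightarrow> e j \<le> 2 * d"
  using e_less[of j] e_last by (cases "j = m - 1") (auto simp: less_le)

lemma pol_order_unit_coeffs: "pol order_unit_coeffs x = 1 + x ^ (2 * d)"
proof -
  have "pol order_unit_coeffs x = (\<Sum>j<m. if j = 0 then x ^ e j else 0) + (\<Sum>j<m. if j = m - 1 then x ^ e j else 0)"
    unfolding poly_span_poly order_unit_coeffs_def distrib_right sum.distrib
    by (intro arg_cong2[where f = "(+)"] sum.cong) auto
  then show ?thesis using m_pos e_first e_last by simp
qed

lemma one_plus_even_power_pos: "0 < 1 + x ^ (2 * d)" for x :: real
  by (simp add: add_pos_nonneg)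

lemma pol_add_scaled: "pol (\<lambda>j. a j + t * b j) x = pol a x + t * pol b x"
  by (simp add: poly_span_poly sum.distrib sum_distrib_left algebra_simps)

lemma pol_scaled: "pol (\<lambda>j. t * b j) x = t * pol b x"
  by (simp add: poly_span_poly sum_distrib_left mult.assoc)

lemma abs_pol_le: "\<bar>pol a x\<bar> \<le> (\<Sum>j<m. \<bar>a j\<bar>) * (1 + x ^ (2 * d))"
proof -
  have "\<bar>x ^ e j\<bar> \<le> 1 + x ^ (2 * d)" if "j < m" for j
  proof (cases "\<bar>x\<bar> \<le> 1")
    case True
    then have "\<bar>x ^ e j\<bar> \<le> 1" by (simp add: power_abs power_le_one)
    moreover have "0 \<le> x ^ (2 * d)" by simp
    ultimately show ?thesis by linarith
  next
    case False
    then have "\<bar>x\<bar> ^ e j \<le> \<bar>x\<bar> ^ (2 * d)" using e_le[OF that] by (intro power_increasing) auto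
    then show ?thesis by (simp add: power_abs power_even_abs)
  qed
  then have "(\<Sum>j<m. \<bar>a j * x ^ e j\<bar>) \<le> (\<Sum>j<m. \<bar>a j\<bar> * (1 + x ^ (2 * d)))"
    by (intro sum_mono) (simp add: abs_mult mult_left_mono)
  then show ?thesis unfolding poly_span_poly sum_distrib_right by (rule order_trans[OF sum_abs])
qed

text \<open>All exponents but the last are at most \<open>2 d - 1\<close>; the surplus factor on the left makes this usable
both for large \<open>x\<close> and at a fixed point.\<close>

lemma leading_term_dominates:
  assumes "\<bar>x\<bar> \<ge> 1"
  shows "\<bar>pol a x - a (m - 1) * x ^ (2 * d)\<bar> * \<bar>x\<bar> \<le> (\<Sum>j<m. \<bar>a j\<bar>) * x ^ (2 * d)"
proof -
  have m: "{..<m} = insert (m - 1) {..<m - 1}" using m_pos by auto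
  have "pol a x - a (m - 1) * x ^ (2 * d) = (\<Sum>j<m - 1. a j * x ^ e j)"
    unfolding poly_span_poly m using e_last by simp
  then have "\<bar>pol a x - a (m - 1) * x ^ (2 * d)\<bar> * \<bar>x\<bar> \<le> (\<Sum>j<m - 1. \<bar>a j * x ^ e j\<bar>) * \<bar>x\<bar>"
    by (simp add: mult_right_mono)
  also have "\<dots> \<le> (\<Sum>j<m - 1. \<bar>a j\<bar> * x ^ (2 * d))"
    unfolding sum_distrib_right
  proof (rule sum_mono)
    fix j assume "j \<in> {..<m - 1}"
    then have "Suc (e j) \<le> 2 * d" using e_less[of j] by simp
    then have "\<bar>x\<bar> ^ Suc (e j) \<le> \<bar>x\<bar> ^ (2 * d)" using assms by (intro power_increasing) auto
    then have "\<bar>a j\<bar> * (\<bar>x\<bar> ^ Suc (e j)) \<le> \<bar>a j\<bar> * x ^ (2 * d)"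
      by (intro mult_left_mono) (auto simp: power_even_abs)
    then show "\<bar>a j * x ^ e j\<bar> * \<bar>x\<bar> \<le> \<bar>a j\<bar> * x ^ (2 * d)"
      by (simp add: abs_mult power_abs mult_ac)
  qed
  also have "\<dots> \<le> (\<Sum>j<m. \<bar>a j\<bar> * x ^ (2 * d))"
    by (intro sum_mono2) auto
  finally show ?thesis by (simp add: sum_distrib_right)
qed

text \<open>A zero of a non-negative function is a minimum, hence a double zero, and unisolvence forbids \<open>k\<close> of
these.\<close>

lemma finite_zeros_of_nonneg:
  assumes nn: "\<And>x. 0 \<le> pol a x" and nz: "\<exists>j<m. a j \<noteq> 0"
  shows "finite {x. pol a x = 0} \<and> card {x. pol a x = 0} < k"
proof -
  have "span_poly m e a \<noteq> 0"
  proof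
    assume z: "span_poly m e a = 0"
    have "a j = 0" if "j < m" for j
      by (rule hermite_unisolventD[OF unisolvent, of "real ` {..<k}"])
        (auto simp: z card_image that)
    with nz show False by blast
  qed
  then have fin: "finite {x. pol a x = 0}" by (rule poly_roots_finite)
  have "\<not> k \<le> card {x. pol a x = 0}"
  proof
    assume "k \<le> card {x. pol a x = 0}"
    then obtain X where X: "X \<subseteq> {x. pol a x = 0}" "card X = k" "finite X"
      using obtain_subset_with_card_n by blast
    have "poly (pderiv (span_poly m e a)) x = 0" if "x \<in> X" for x
    proof (rule DERIV_local_min[OF poly_DERIV])
      show "0 < (1 :: real)" by simp
      show "\<forall>y. \<bar>x - y\<bar> < 1 \<longrightarrow> pol a x \<le> pol a y" using nn X(1) that by auto
    qed
    then have "a j = 0" if "j < m" for j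
      using hermite_unisolventD[OF unisolvent X(3,2) _ _ that, of a] X(1) by blast
    with nz show False by blast
  qed
  with fin show ?thesis by simp
qed

text \<open>Where \<open>b\<close> is positive there is nothing to show. The remaining points form a closed set that misses
the zeros of \<open>a\<close>; on it \<open>a\<close> is bounded below by a multiple of \<open>1 + x\<^sup>2\<^sup>d\<close>, by compactness on a
bounded interval and by the positive leading coefficient outside of it.\<close>

lemma nonneg_perturbation:
  assumes nn: "\<And>x. 0 \<le> pol a x" and lead: "a (m - 1) > 0"
    and pos: "\<And>x. pol a x = 0 \<Longrightarrow> 0 < pol b x"
  shows "\<exists>\<epsilon>>0. \<forall>x. 0 \<le> pol a x + \<epsilon> * pol b x"
proof -
  define A where "A = (\<Sum>j<m. \<bar>a j\<bar>)"
  define B where "B = (\<Sum>j<m. \<bar>b j\<bar>)"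
  \<comment> \<open>Beyond \<open>R\<close> the lower order terms amount to at most half of the leading term.\<close>
  define R where "R = max 1 (2 * A / a (m - 1))"
  define q where "q x = pol a x / (1 + x ^ (2 * d))" for x
  define T where "T = {x. pol b x \<le> 0} \<inter> {- R..R}"
  have far: "a (m - 1) / 4 \<le> q x" if "\<bar>x\<bar> \<ge> R" for x
  proof -
    have x: "\<bar>x\<bar> \<ge> 1" "\<bar>x\<bar> * a (m - 1) \<ge> 2 * A"
      using that lead by (auto simp: R_def field_simps)
    have p1: "1 \<le> x ^ (2 * d)"
      using one_le_power[OF x(1), of "2 * d"] by (simp add: power_even_abs)
    have "\<bar>pol a x - a (m - 1) * x ^ (2 * d)\<bar> * \<bar>x\<bar> \<le> A * x ^ (2 * d)"
      unfolding A_def by (rule leading_term_dominates[OF x(1)])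
    also have "\<dots> \<le> (\<bar>x\<bar> * a (m - 1) / 2) * x ^ (2 * d)"
      using x(2) p1 by (intro mult_right_mono) auto
    finally have "\<bar>pol a x - a (m - 1) * x ^ (2 * d)\<bar> * \<bar>x\<bar> \<le> (a (m - 1) / 2 * x ^ (2 * d)) * \<bar>x\<bar>"
      by (simp add: mult_ac)
    then have "\<bar>pol a x - a (m - 1) * x ^ (2 * d)\<bar> \<le> a (m - 1) / 2 * x ^ (2 * d)"
      using x(1) by (subst (asm) mult_le_cancel_right) auto
    from abs_le_D2[OF this] have "a (m - 1) / 2 * x ^ (2 * d) \<le> pol a x"
      by (simp add: field_simps)
    moreover have "a (m - 1) / 4 * (1 + x ^ (2 * d)) \<le> a (m - 1) / 4 * (2 * x ^ (2 * d))"
      using lead p1 by (intro mult_left_mono) auto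
    ultimately have "a (m - 1) / 4 * (1 + x ^ (2 * d)) \<le> pol a x" by simp
    then show ?thesis using one_plus_even_power_pos[of x] by (simp add: q_def pos_le_divide_eq)
  qed
  have "1 + x ^ (2 * d) \<noteq> 0" for x :: real using one_plus_even_power_pos[of x] by linarith
  then have contq: "continuous_on UNIV q"
    unfolding q_def by (intro continuous_on_divide continuous_intros ballI)
  have "closed {x. pol b x \<le> 0}"
    by (intro closed_Collect_le continuous_intros)
  then have "compact T" unfolding T_def by (intro closed_Int_compact) auto
  have "\<exists>c>0. \<forall>x\<in>T. c \<le> q x"
  proof (cases "T = {}")
    case False
    obtain x0 where x0: "x0 \<in> T" "\<forall>x\<in>T. q x0 \<le> q x"
      using continuous_attains_inf[OF \<open>compact T\<close> False] contq continuous_on_subset by blast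
    have "pol a x0 \<noteq> 0"
    proof
      assume "pol a x0 = 0"
      then have "0 < pol b x0" by (rule pos)
      with x0(1) show False by (simp add: T_def)
    qed
    with nn[of x0] have "0 < pol a x0" by linarith
    then have "0 < q x0" unfolding q_def by (intro divide_pos_pos one_plus_even_power_pos)
    with x0(2) show ?thesis by blast
  qed (auto intro: exI[of _ 1])
  then obtain c where c: "c > 0" "\<forall>x\<in>T. c \<le> q x" by blast
  define c' where "c' = min c (a (m - 1) / 4)"
  have c': "c' > 0" using c(1) lead by (simp add: c'_def)
  have B: "0 \<le> B" by (simp add: B_def sum_nonneg)
  have "0 \<le> pol a x + c' / (1 + B) * pol b x" for x
  proof (cases "pol b x \<le> 0")
    case False
    then show ?thesis using nn[of x] c' B by (intro add_nonneg_nonneg mult_nonneg_nonneg) auto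
  next
    case True
    have "c' \<le> q x"
    proof (cases "\<bar>x\<bar> \<le> R")
      case True
      then have "x \<in> T" using \<open>pol b x \<le> 0\<close> by (auto simp: T_def abs_le_iff)
      then show ?thesis using c(2) by (auto simp: c'_def)
    qed (use far[of x] in \<open>auto simp: c'_def\<close>)
    then have "c' * (1 + x ^ (2 * d)) \<le> pol a x"
      using one_plus_even_power_pos[of x] by (simp add: q_def pos_le_divide_eq)
    moreover have "c' / (1 + B) * \<bar>pol b x\<bar> \<le> c' / (1 + B) * ((1 + B) * (1 + x ^ (2 * d)))"
    proof (rule mult_left_mono)
      have "\<bar>pol b x\<bar> \<le> B * (1 + x ^ (2 * d))" unfolding B_def by (rule abs_pol_le)
      also have "\<dots> \<le> (1 + B) * (1 + x ^ (2 * d))" using one_plus_even_power_pos[of x] by (intro mult_right_mono) auto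
      finally show "\<bar>pol b x\<bar> \<le> (1 + B) * (1 + x ^ (2 * d))" .
    qed (use c' B in auto)
    then have "c' / (1 + B) * \<bar>pol b x\<bar> \<le> c' * (1 + x ^ (2 * d))" using B by simp
    moreover have "c' / (1 + B) * pol b x = - (c' / (1 + B) * \<bar>pol b x\<bar>)" using True by simp
    ultimately show ?thesis by linarith
  qed
  moreover have "c' / (1 + B) > 0" using c' B by simp
  ultimately show ?thesis by blast
qed

text \<open>A non-negative functional \<open>L\<close> that vanishes at a non-negative \<open>a\<close> is a combination of evaluations
at the zeros of \<open>a\<close>. If \<open>b\<close> is non-negative on the zeros only, then \<open>L b\<close> is still non-negative:
\<open>b\<close> plus a small multiple of \<open>1 + x\<^sup>2\<^sup>d\<close> is positive there, so adding a small multiple of it to \<open>a\<close>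
keeps \<open>a\<close> non-negative. In particular \<open>L\<close> vanishes at every \<open>b\<close> that is zero on the zeros of \<open>a\<close>,
and the weights are the values of \<open>L\<close> at the functions of an interpolation basis.\<close>

lemma nonneg_functional_vanishing_at:
  assumes s: "\<And>b. (\<And>x. 0 \<le> pol b x) \<Longrightarrow> 0 \<le> (\<Sum>j<m. b j * s j)"
    and nn: "\<And>x. 0 \<le> pol a x" and lead: "a (m - 1) > 0" and La: "(\<Sum>j<m. a j * s j) = 0"
  obtains w where "\<And>z. 0 \<le> (w z :: real)" "\<And>j. j < m \<Longrightarrow> s j = (\<Sum>z | pol a z = 0. w z * z ^ e j)"
proof -
  define L where "L b = (\<Sum>j<m. b j * s j)" for b :: "nat \<Rightarrow> real"
  define Z where "Z = {z. pol a z = 0}"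
  have L_lin: "L (\<lambda>j. b j + t * c j) = L b + t * L c" for b c t
    by (simp add: L_def sum.distrib sum_distrib_left algebra_simps)
  have L_nonneg: "0 \<le> L b" if b: "\<And>z. z \<in> Z \<Longrightarrow> 0 \<le> pol b z" for b
  proof (rule field_le_epsilon)
    fix \<delta> :: real assume \<delta>: "0 < \<delta>"
    have Lu: "0 \<le> L order_unit_coeffs"
      unfolding L_def using one_plus_even_power_pos by (intro s) (auto simp: pol_order_unit_coeffs less_imp_le)
    \<comment> \<open>The added \<open>1\<close> avoids a division by zero.\<close>
    define \<eta> where "\<eta> = \<delta> / (L order_unit_coeffs + 1)"
    have \<eta>: "\<eta> > 0" using \<delta> Lu by (simp add: \<eta>_def)
    have "0 < pol (\<lambda>j. b j + \<eta> * order_unit_coeffs j) x" if "pol a x = 0" for x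
    proof -
      have "0 \<le> pol b x" using b[of x] that by (simp add: Z_def)
      moreover have "0 < \<eta> * (1 + x ^ (2 * d))" using \<eta> one_plus_even_power_pos[of x] by (rule mult_pos_pos)
      ultimately show ?thesis unfolding pol_add_scaled pol_order_unit_coeffs by linarith
    qed
    then obtain \<epsilon> where \<epsilon>: "\<epsilon> > 0" "\<forall>x. 0 \<le> pol a x + \<epsilon> * pol (\<lambda>j. b j + \<eta> * order_unit_coeffs j) x"
      using nonneg_perturbation[OF nn lead] by blast
    have "0 \<le> L (\<lambda>j. a j + \<epsilon> * (b j + \<eta> * order_unit_coeffs j))"
      unfolding L_def using \<epsilon>(2) by (intro s) (simp only: pol_add_scaled)
    then have "0 \<le> \<epsilon> * (L b + \<eta> * L order_unit_coeffs)"
      using La by (simp only: L_lin) (simp add: L_def)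
    then have "0 \<le> L b + \<eta> * L order_unit_coeffs" using \<epsilon>(1) by (simp add: zero_le_mult_iff)
    also have "\<eta> * L order_unit_coeffs \<le> \<delta>" using \<delta> Lu by (simp add: \<eta>_def field_simps)
    finally show "0 \<le> L b + \<delta>" by simp
  qed
  have "\<exists>j<m. a j \<noteq> 0" using lead m_pos by (intro exI[of _ "m - 1"]) auto
  from finite_zeros_of_nonneg[OF nn this] have fin: "finite Z" and card: "card Z < k"
    by (simp_all add: Z_def)
  have "infinite (UNIV - Z)" using fin infinite_UNIV_char_0 by (rule Diff_infinite_finite)
  then obtain B where B: "finite B" "card B = k - card Z" "B \<subseteq> UNIV - Z"
    using infinite_arbitrarily_large by blast
  define X where "X = Z \<union> B"
  have "card X = k"
    unfolding X_def using B fin card by (subst card_Un_disjoint) auto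
  then have X: "Z \<subseteq> X" "finite X" "card X = k" using B fin by (auto simp: X_def)
  have "\<exists>b. \<forall>x\<in>X. pol b x = v x" for v
    using unisolvent X(2,3) by (simp add: hermite_unisolvent_def)
  then have "\<forall>z. \<exists>b. \<forall>x\<in>X. pol b x = (if x = z then 1 else 0)" by (intro allI)
  from choice[OF this] obtain g where "\<forall>z. \<forall>x\<in>X. pol (g z) x = (if x = z then 1 else 0)" ..
  then have g: "pol (g z) x = (if x = z then 1 else 0)" if "x \<in> Z" for z x
    using that X(1) by (simp add: subset_iff)
  define w where "w z = (if z \<in> Z then L (g z) else 0)" for z
  show thesis
  proof (rule that[of w])
    have "0 \<le> L (g z)" for z by (intro L_nonneg) (simp add: g)
    then show "0 \<le> w z" for z by (simp add: w_def)
    fix j assume j: "j < m"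
    \<comment> \<open>The \<open>j\<close>-th monomial minus its interpolant; it vanishes on the zeros of \<open>a\<close>.\<close>
    define b where "b i = (if i = j then 1 else 0) - (\<Sum>z\<in>Z. z ^ e j * g z i)" for i
    have pb: "pol b x = x ^ e j - (\<Sum>z\<in>Z. z ^ e j * pol (g z) x)" for x
    proof -
      have "pol b x = (\<Sum>i<m. (if i = j then x ^ e i else 0)) - (\<Sum>i<m. \<Sum>z\<in>Z. z ^ e j * g z i * x ^ e i)"
        unfolding poly_span_poly b_def left_diff_distrib sum_subtractf sum_distrib_right
        by (intro arg_cong2[where f = "(-)"] sum.cong) auto
      also have "(\<Sum>i<m. \<Sum>z\<in>Z. z ^ e j * g z i * x ^ e i) = (\<Sum>z\<in>Z. z ^ e j * pol (g z) x)"
        by (subst sum.swap) (simp add: poly_span_poly sum_distrib_left mult.assoc)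
      finally show ?thesis using j by simp
    qed
    have Lb: "L b = s j - (\<Sum>z\<in>Z. z ^ e j * L (g z))"
    proof -
      have "L b = (\<Sum>i<m. (if i = j then s i else 0)) - (\<Sum>i<m. \<Sum>z\<in>Z. z ^ e j * g z i * s i)"
        unfolding L_def b_def left_diff_distrib sum_subtractf sum_distrib_right
        by (intro arg_cong2[where f = "(-)"] sum.cong) auto
      also have "(\<Sum>i<m. \<Sum>z\<in>Z. z ^ e j * g z i * s i) = (\<Sum>z\<in>Z. z ^ e j * L (g z))"
        by (subst sum.swap) (simp add: L_def sum_distrib_left mult.assoc)
      finally show ?thesis using j by simp
    qed
    have b0: "pol b x = 0" if "x \<in> Z" for x
    proof -
      have "(\<Sum>z\<in>Z. z ^ e j * pol (g z) x) = (\<Sum>z\<in>Z. if z = x then z ^ e j else 0)"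
      proof (intro sum.cong refl)
        fix z assume "z \<in> Z"
        have "pol (g z) x = (if x = z then 1 else 0)" using g[OF that] .
        then show "z ^ e j * pol (g z) x = (if z = x then z ^ e j else 0)" by simp
      qed
      then show ?thesis using that fin by (simp add: pb)
    qed
    have "0 \<le> L b" using b0 by (intro L_nonneg) auto
    moreover have "pol (\<lambda>j. - 1 * b j) z = 0" if "z \<in> Z" for z
      by (subst pol_scaled) (simp add: b0 that)
    then have "0 \<le> L (\<lambda>j. - 1 * b j)" by (intro L_nonneg) simp
    then have "0 \<le> - L b" by (simp add: L_def sum_negf)
    ultimately have "L b = 0" by simp
    then show "s j = (\<Sum>z | pol a z = 0. w z * z ^ e j)"
      unfolding Lb Z_def[symmetric] by (simp add: w_def mult.commute)
  qed
qed

lemma closed_nonneg: "closed {a. \<forall>x. 0 \<le> pol a x}"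
proof -
  have "closed {a. 0 \<le> pol a x}" for x
    unfolding poly_span_poly
    by (intro closed_Collect_le continuous_on_const continuous_on_linear_functional)
  then show ?thesis by (rule closed_Collect_all)
qed

lemma closed_coeffs_supported: "closed {a :: nat \<Rightarrow> real. \<forall>j\<ge>m. a j = 0}"
  by (intro closed_Collect_all closed_Collect_imp closed_Collect_eq continuous_on_const
      continuous_on_product_coordinates) auto

text \<open>A strictly positive functional is bounded below on the compact set of normalised non-negative
combinations.\<close>

lemma positive_functional_coercive:
  assumes s: "\<And>a. (\<And>x. 0 \<le> pol a x) \<Longrightarrow> \<exists>j<m. a j \<noteq> 0 \<Longrightarrow> 0 < (\<Sum>j<m. a j * s j)"
  obtains \<delta> where "\<delta> > 0" "\<And>a. (\<And>x. 0 \<le> pol a x) \<Longrightarrow> \<delta> * (\<Sum>j<m. \<bar>a j\<bar>) \<le> (\<Sum>j<m. a j * s j)"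
proof -
  define K where "K = {a. \<forall>j\<ge>m. a j = 0} \<inter> {a. \<forall>x. 0 \<le> pol a x} \<inter> {a. (\<Sum>j<m. \<bar>a j\<bar>) = 1}"
  have "closed {a :: nat \<Rightarrow> real. (\<Sum>j<m. \<bar>a j\<bar>) = 1}"
    by (intro closed_Collect_eq continuous_intros continuous_on_product_coordinates)
  then have "closed K" unfolding K_def by (intro closed_Int closed_coeffs_supported closed_nonneg)
  moreover have "(\<forall>j<m. \<bar>a j\<bar> \<le> 1) \<and> (\<forall>j\<ge>m. a j = 0)" if "a \<in> K" for a
  proof -
    have "\<bar>a j\<bar> \<le> 1" if "j < m" for j
      using member_le_sum[of j "{..<m}" "\<lambda>j. \<bar>a j\<bar>"] that \<open>a \<in> K\<close> by (simp add: K_def)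
    then show ?thesis using that by (simp add: K_def)
  qed
  ultimately have "compact K" by (rule compact_bounded_coefficients)
  have "\<exists>\<delta>>0. \<forall>a\<in>K. \<delta> \<le> (\<Sum>j<m. a j * s j)"
  proof (cases "K = {}")
    case False
    obtain a where a: "a \<in> K" "\<forall>b\<in>K. (\<Sum>j<m. a j * s j) \<le> (\<Sum>j<m. b j * s j)"
      using continuous_attains_inf[OF \<open>compact K\<close> False, of "\<lambda>a. \<Sum>j<m. a j * s j"]
        continuous_on_linear_functional continuous_on_subset by blast
    have "\<exists>j<m. a j \<noteq> 0"
    proof (rule ccontr)
      assume "\<not> ?thesis"
      then have "(\<Sum>j<m. \<bar>a j\<bar>) = 0" by simp
      with a(1) show False by (simp add: K_def)
    qed
    then have "0 < (\<Sum>j<m. a j * s j)" using a(1) by (intro s) (auto simp: K_def)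
    with a(2) show ?thesis by blast
  qed (auto intro: exI[of _ 1])
  then obtain \<delta> where \<delta>: "\<delta> > 0" "\<And>a. a \<in> K \<Longrightarrow> \<delta> \<le> (\<Sum>j<m. a j * s j)" by blast
  have "\<delta> * (\<Sum>j<m. \<bar>a j\<bar>) \<le> (\<Sum>j<m. a j * s j)" if nn: "\<And>x. 0 \<le> pol a x" for a
  proof (cases "\<exists>j<m. a j \<noteq> 0")
    case False
    then show ?thesis by simp
  next
    case True
    define r where "r = (\<Sum>j<m. \<bar>a j\<bar>)"
    have r: "r > 0" using True unfolding r_def by (auto intro!: sum_pos2)
    define b where "b j = (if j < m then (1 / r) * a j else 0)" for j
    have "span_poly m e b = span_poly m e (\<lambda>j. (1 / r) * a j)"
      unfolding span_poly_def by (intro sum.cong) (auto simp: b_def)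
    then have "pol b x = (1 / r) * pol a x" for x by (simp only: pol_scaled)
    moreover have "(\<Sum>j<m. \<bar>b j\<bar>) = (1 / r) * r"
      using r by (simp add: b_def r_def abs_mult sum_distrib_left)
    ultimately have "b \<in> K" using nn r by (auto simp: K_def b_def)
    moreover have "(\<Sum>j<m. b j * s j) = (1 / r) * (\<Sum>j<m. a j * s j)"
      by (simp add: b_def sum_distrib_left mult.assoc)
    ultimately have "\<delta> \<le> (1 / r) * (\<Sum>j<m. a j * s j)" using \<delta>(2) by metis
    then show ?thesis using r by (simp add: field_simps flip: r_def)
  qed
  with \<delta>(1) that show thesis by blast
qed

text \<open>The mass split off at the point \<open>N\<close> is the minimum of \<open>L f / f(N)\<close> over non-negative \<open>f\<close>, with the
denominator normalised to \<open>1 + N\<^sup>2\<^sup>d\<close>. Every competitor has norm at most \<open>H / \<delta>\<close>, independently of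
\<open>N\<close>. If the leading coefficient of the minimiser were zero, its value at \<open>N\<close> could only be of the
order \<open>N\<close> to the power \<open>2 d - 1\<close>, which is too small for large \<open>N\<close>.\<close>

lemma interior_functional_atoms:
  assumes s: "\<And>a. (\<And>x. 0 \<le> pol a x) \<Longrightarrow> \<exists>j<m. a j \<noteq> 0 \<Longrightarrow> 0 < (\<Sum>j<m. a j * s j)"
  shows "\<exists>Z w. finite Z \<and> card Z \<le> k \<and> (\<forall>z. 0 \<le> w z) \<and> (\<forall>j<m. s j = (\<Sum>z\<in>Z. w z * z ^ e j))"
proof -
  define L where "L b = (\<Sum>j<m. b j * s j)" for b :: "nat \<Rightarrow> real"
  have L_scaled: "L (\<lambda>j. t * b j) = t * L b" for t b
    by (simp add: L_def sum_distrib_left mult.assoc)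
  obtain \<delta> where \<delta>: "\<delta> > 0" "\<And>a. (\<And>x. 0 \<le> pol a x) \<Longrightarrow> \<delta> * (\<Sum>j<m. \<bar>a j\<bar>) \<le> L a"
    using positive_functional_coercive[of s, OF s] unfolding L_def by blast
  \<comment> \<open>The combination \<open>1 + x\<^sup>2\<^sup>d\<close> is a competitor, so values of \<open>L\<close> above \<open>H\<close> may be disregarded.\<close>
  define H where "H = L order_unit_coeffs"
  define N where "N = max 1 (H / \<delta>) + 1"
  have N: "N > 1" "N > H / \<delta>" by (auto simp: N_def)
  define hN where "hN = 1 + N ^ (2 * d)"
  have hN: "hN > 0" using one_plus_even_power_pos[of N] by (simp add: hN_def)
  define T where "T = {a. \<forall>j\<ge>m. a j = 0} \<inter> {a. \<forall>x. 0 \<le> pol a x} \<inter> {a. pol a N = hN} \<inter> {a. L a \<le> H}"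
  have norm_le: "(\<Sum>j<m. \<bar>a j\<bar>) \<le> H / \<delta>" if "a \<in> T" for a
  proof -
    have "\<delta> * (\<Sum>j<m. \<bar>a j\<bar>) \<le> H" using \<delta>(2)[of a] that by (auto simp: T_def)
    then show ?thesis using \<delta>(1) by (simp add: field_simps)
  qed
  have "closed T" unfolding T_def L_def poly_span_poly[of m e _ N]
    by (intro closed_Int closed_coeffs_supported closed_nonneg closed_Collect_eq closed_Collect_le
        continuous_on_const continuous_on_linear_functional)
  moreover have "(\<forall>j<m. \<bar>a j\<bar> \<le> H / \<delta>) \<and> (\<forall>j\<ge>m. a j = 0)" if "a \<in> T" for a
  proof -
    have "\<bar>a j\<bar> \<le> H / \<delta>" if "j < m" for j
      using member_le_sum[of j "{..<m}" "\<lambda>j. \<bar>a j\<bar>"] that norm_le[OF \<open>a \<in> T\<close>] by simp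
    then show ?thesis using that by (simp add: T_def)
  qed
  ultimately have "compact T" by (rule compact_bounded_coefficients)
  have u: "order_unit_coeffs \<in> T"
    using m_pos one_plus_even_power_pos by (auto simp: T_def pol_order_unit_coeffs hN_def H_def order_unit_coeffs_def less_imp_le)
  have "continuous_on T L"
    unfolding L_def using continuous_on_linear_functional continuous_on_subset by blast
  then obtain a where a: "a \<in> T" "\<forall>b\<in>T. L a \<le> L b"
    using continuous_attains_inf[OF \<open>compact T\<close>, of L] u by blast
  have nn: "0 \<le> pol a x" for x using a(1) by (simp add: T_def)
  have aN: "pol a N = hN" using a(1) by (simp add: T_def)
  have aH: "L a \<le> H" using a(1) by (simp add: T_def)
  have lead: "a (m - 1) > 0"
  proof (rule ccontr)
    assume neg: "\<not> a (m - 1) > 0"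
    have N0: "N ^ (2 * d) > 0" using N by simp
    have "N ^ (2 * d) * N \<le> hN * N" using N by (simp add: hN_def)
    also have "\<dots> \<le> \<bar>pol a N - a (m - 1) * N ^ (2 * d)\<bar> * \<bar>N\<bar>"
    proof -
      have "a (m - 1) * N ^ (2 * d) \<le> 0" using neg N0 by (simp add: mult_nonpos_nonneg)
      then show ?thesis using N unfolding aN by (intro mult_mono) auto
    qed
    also have "\<dots> \<le> (\<Sum>j<m. \<bar>a j\<bar>) * N ^ (2 * d)"
      using N by (intro leading_term_dominates) auto
    also have "\<dots> \<le> H / \<delta> * N ^ (2 * d)" using norm_le[OF a(1)] N0 by (intro mult_right_mono) auto
    finally have "N ^ (2 * d) * N \<le> N ^ (2 * d) * (H / \<delta>)" by (simp only: mult.commute)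
    then have "N \<le> H / \<delta>" using N0 by (rule mult_left_le_imp_le)
    with N show False by simp
  qed
  define c where "c = L a / hN"
  have La: "0 < L a" unfolding L_def using lead m_pos by (intro s nn exI[of _ "m - 1"]) auto
  have c: "c > 0" using La hN by (simp add: c_def)
  \<comment> \<open>The moments of the remainder after the atom at \<open>N\<close> has been split off.\<close>
  define s' where "s' j = s j - c * N ^ e j" for j
  have Ls': "(\<Sum>j<m. b j * s' j) = L b - c * pol b N" for b
    by (simp add: s'_def L_def poly_span_poly sum_subtractf sum_distrib_left algebra_simps)
  have s'_nonneg: "0 \<le> (\<Sum>j<m. b j * s' j)" if b: "\<And>x. 0 \<le> pol b x" for b
  proof (cases "pol b N = 0")
    case True
    have "0 \<le> \<delta> * (\<Sum>j<m. \<bar>b j\<bar>)" using \<delta>(1) by (simp add: sum_nonneg)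
    also have "\<dots> \<le> L b" using b by (rule \<delta>(2))
    finally show ?thesis unfolding Ls' True by simp
  next
    case False
    then have pbN: "pol b N > 0" using b[of N] by simp
    define t where "t = hN / pol b N"
    have t: "t > 0" using hN pbN by (simp add: t_def)
    define b' where "b' j = (if j < m then t * b j else 0)" for j
    have "span_poly m e b' = span_poly m e (\<lambda>j. t * b j)"
      unfolding span_poly_def by (intro sum.cong) (auto simp: b'_def)
    then have pb': "pol b' x = t * pol b x" for x by (simp only: pol_scaled)
    have "L b' = L (\<lambda>j. t * b j)" unfolding L_def by (intro sum.cong) (auto simp: b'_def)
    then have Lb': "L b' = t * L b" by (simp only: L_scaled)
    have "L a \<le> t * L b"
    proof (cases "t * L b \<le> H")
      case True
      have "0 \<le> pol b' x" for x using b[of x] t by (simp add: pb')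
      moreover have "pol b' N = hN" using pbN by (simp add: pb' t_def)
      ultimately have "b' \<in> T" using True by (simp add: T_def Lb' b'_def)
      then show ?thesis using a(2) Lb' by metis
    qed (use aH in auto)
    then have "L a / t \<le> L b" using t by (simp add: field_simps)
    then show ?thesis unfolding Ls' c_def t_def by simp
  qed
  have "(\<Sum>j<m. a j * s' j) = 0" unfolding Ls' aN c_def using hN by simp
  then obtain w where w: "\<And>z. 0 \<le> w z" "\<And>j. j < m \<Longrightarrow> s' j = (\<Sum>z | pol a z = 0. w z * z ^ e j)"
    using nonneg_functional_vanishing_at[OF s'_nonneg nn lead] by blast
  define Z where "Z = {z. pol a z = 0}"
  have "\<exists>j<m. a j \<noteq> 0" using lead m_pos by (intro exI[of _ "m - 1"]) auto
  from finite_zeros_of_nonneg[OF nn this] have Z: "finite Z" "card Z < k"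
    by (simp_all add: Z_def)
  have NZ: "N \<notin> Z" using aN hN by (simp add: Z_def)
  define w' where "w' = w(N := c)"
  have "s j = (\<Sum>z\<in>insert N Z. w' z * z ^ e j)" if "j < m" for j
  proof -
    have "(\<Sum>z\<in>Z. w' z * z ^ e j) = (\<Sum>z\<in>Z. w z * z ^ e j)"
      using NZ by (intro sum.cong) (auto simp: w'_def)
    also have "\<dots> = s' j" using w(2)[OF that] by (simp add: Z_def)
    finally show ?thesis using Z(1) NZ by (simp add: w'_def s'_def)
  qed
  moreover have "\<forall>z. 0 \<le> w' z" using w(1) c by (simp add: w'_def)
  moreover have "card (insert N Z) \<le> k" using Z NZ by simp
  ultimately show ?thesis using Z(1) by blast
qed

end

section \<open>Atomic measures and moment sequences\<close>

lemma space_borel_top [simp]: "space (borel_top T) = topspace T"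
  unfolding borel_top_def using openin_subset[of T] by (subst space_measure_of) auto

lemma openin_in_sets_borel_top: "openin T U \<Longrightarrow> U \<in> sets (borel_top T)"
  unfolding borel_top_def using openin_subset[of T] by (subst sets_measure_of) auto

text \<open>Points are closed, so atoms can be read off from a Borel measure.\<close>

lemma singleton_in_sets_borel_top:
  assumes "t1_space T" "p \<in> topspace T"
  shows "{p} \<in> sets (borel_top T)"
proof -
  have "closedin T {p}" using assms by (simp add: t1_space_closedin_singleton)
  then have "topspace T - (topspace T - {p}) \<in> sets (borel_top T)"
    using openin_in_sets_borel_top[of T "topspace T - {p}"] sets.compl_sets[of _ "borel_top T"]
    by (simp add: closedin_def)
  moreover have "topspace T - (topspace T - {p}) = {p}" using assms(2) by auto
  ultimately show ?thesis by simp
qed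

text \<open>Built as an image of a measure on the indices; repeated points and zero weights are therefore
allowed.\<close>

definition atoms :: "'a topology \<Rightarrow> nat \<Rightarrow> (nat \<Rightarrow> real) \<Rightarrow> (nat \<Rightarrow> 'a) \<Rightarrow> 'a measure" where
  "atoms T n c x = distr (point_measure {..<n} (\<lambda>i. ennreal (c i))) (borel_top T) x"

lemma sets_atoms: "sets (atoms T n c x) = sets (borel_top T)"
  by (simp add: atoms_def)

lemma emeasure_atoms:
  assumes x: "\<And>i. i < n \<Longrightarrow> x i \<in> topspace T" and B: "B \<in> sets (borel_top T)"
  shows "emeasure (atoms T n c x) B = (\<Sum>i<n. ennreal (c i) * indicator B (x i))"
proof -
  have "x \<in> measurable (point_measure {..<n} (\<lambda>i. ennreal (c i))) (borel_top T)"
    using x by auto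
  then have "emeasure (atoms T n c x) B
      = emeasure (point_measure {..<n} (\<lambda>i. ennreal (c i))) (x -` B \<inter> {..<n})"
    unfolding atoms_def using B by (subst emeasure_distr) (auto simp: space_point_measure)
  also have "\<dots> = (\<Sum>i\<in>x -` B \<inter> {..<n}. ennreal (c i))"
    by (intro emeasure_point_measure_finite) auto
  also have "\<dots> = (\<Sum>i<n. ennreal (c i) * indicator B (x i))"
    by (intro sum.mono_neutral_cong_left) (auto simp: indicator_def split: if_splits)
  finally show ?thesis .
qed

lemma integral_atoms:
  assumes x: "\<And>i. i < n \<Longrightarrow> x i \<in> topspace T" and c: "\<And>i. i < n \<Longrightarrow> 0 \<le> c i"
    and f: "f \<in> borel_measurable (borel_top T)"
  shows "integrable (atoms T n c x) f" "integral\<^sup>L (atoms T n c x) f = (\<Sum>i<n. c i * f (x i))"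
proof -
  have xm: "x \<in> measurable (point_measure {..<n} (\<lambda>i. ennreal (c i))) (borel_top T)"
    using x by auto
  show "integrable (atoms T n c x) f"
    unfolding atoms_def integrable_distr_eq[OF xm f] by (rule integrable_point_measure_finite) simp
  show "integral\<^sup>L (atoms T n c x) f = (\<Sum>i<n. c i * f (x i))"
    unfolding atoms_def integral_distr[OF xm f] using c
    by (subst lebesgue_integral_point_measure_finite) auto
qed

text \<open>The mass of a set is already carried by the finitely many atoms in it, a compact measurable set.\<close>

lemma radon_measure_atoms:
  assumes T: "t1_space T" and x: "\<And>i. i < n \<Longrightarrow> x i \<in> topspace T"
  shows "radon_measure T (atoms T n c x)"
  unfolding radon_measure_def
proof (intro conjI allI impI ballI)
  show "sets (atoms T n c x) = sets (borel_top T)" by (rule sets_atoms)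
next
  fix K
  show "emeasure (atoms T n c x) K < \<infinity>"
  proof (cases "K \<in> sets (borel_top T)")
    case True
    then show ?thesis by (simp add: emeasure_atoms x ennreal_mult_less_top indicator_def)
  qed (simp add: emeasure_notin_sets sets_atoms)
next
  fix B assume "B \<in> sets (atoms T n c x)"
  then have B: "B \<in> sets (borel_top T)" by (simp add: sets_atoms)
  define K where "K = x ` {..<n} \<inter> B"
  have "K \<subseteq> topspace T" using x by (auto simp: K_def)
  have K: "compactin T K" by (rule finite_imp_compactin) (use x in \<open>auto simp: K_def\<close>)
  have "(\<Union>p\<in>K. {p}) \<in> sets (borel_top T)"
    using singleton_in_sets_borel_top[OF T] \<open>K \<subseteq> topspace T\<close> by (intro sets.finite_UN) (auto simp: K_def)
  then have Ks: "K \<in> sets (borel_top T)" by simp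
  have em: "emeasure (atoms T n c x) A = (\<Sum>i<n. ennreal (c i) * indicator A (x i))"
    if "A \<in> sets (borel_top T)" for A
    using x that by (rule emeasure_atoms)
  have "emeasure (atoms T n c x) B = emeasure (atoms T n c x) K"
    unfolding em[OF B] em[OF Ks]
    by (intro sum.cong) (auto simp: K_def indicator_def)
  also have "\<dots> \<le> (SUP K\<in>{K. compactin T K \<and> K \<subseteq> B}. emeasure (atoms T n c x) K)"
    using K by (intro SUP_upper) (auto simp: K_def)
  finally show "emeasure (atoms T n c x) B
      = (SUP K\<in>{K. compactin T K \<and> K \<subseteq> B}. emeasure (atoms T n c x) K)"
    using B by (intro antisym SUP_least emeasure_mono) (auto simp: sets_atoms)
qed

lemma representing_measure_atoms:
  assumes T: "t1_space T" and f: "\<And>j. j < m \<Longrightarrow> f j \<in> borel_measurable (borel_top T)"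
    and x: "\<And>i. i < n \<Longrightarrow> x i \<in> topspace T" and c: "\<And>i. i < n \<Longrightarrow> 0 \<le> c i"
    and s: "\<And>j. j < m \<Longrightarrow> s j = (\<Sum>i<n. c i * f j (x i))"
  shows "representing_measure T m f s (atoms T n c x)"
  unfolding representing_measure_def
  using radon_measure_atoms[OF T x] integral_atoms[where T = T, OF x c f] s by simp

lemma atomic_representing_measureD:
  assumes A: "atomic_measure T n M" and R: "representing_measure T m f s M"
    and f: "\<And>j. j < m \<Longrightarrow> f j \<in> borel_measurable (borel_top T)"
  obtains c x where "\<And>i. i < n \<Longrightarrow> 0 < c i" "\<And>i. i < n \<Longrightarrow> x i \<in> topspace T"
    "\<And>j. j < m \<Longrightarrow> s j = (\<Sum>i<n. c i * f j (x i))"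
proof -
  obtain c x where cx: "\<And>i. i < n \<Longrightarrow> 0 < c i" "\<And>i. i < n \<Longrightarrow> x i \<in> topspace T"
    and em: "\<And>B. B \<in> sets M \<Longrightarrow> emeasure M B = (\<Sum>i<n. ennreal (c i) * indicator B (x i))"
    and sets: "sets M = sets (borel_top T)"
    using A unfolding atomic_measure_def by blast
  have "M = atoms T n c x"
    by (rule measure_eqI) (simp_all add: sets_atoms sets em emeasure_atoms cx(2))
  then have "s j = (\<Sum>i<n. c i * f j (x i))" if "j < m" for j
    using R that integral_atoms(2)[OF cx(2) less_imp_le[OF cx(1)] f[OF that]]
    by (simp add: representing_measure_def)
  with cx show thesis using that by blast
qed

text \<open>Points of weight zero are dropped, because an atomic measure has positive weights; this is why the
number of atoms is only bounded by the number of points.\<close>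

lemma exists_atomic_representing_measure:
  assumes T: "t1_space T" and f: "\<And>j. j < m \<Longrightarrow> f j \<in> borel_measurable (borel_top T)"
    and Z: "finite Z" "Z \<subseteq> topspace T" and w: "\<And>z. z \<in> Z \<Longrightarrow> 0 \<le> (w z :: real)"
    and s: "\<And>j. j < m \<Longrightarrow> s j = (\<Sum>z\<in>Z. w z * f j z)"
  shows "\<exists>n\<le>card Z. \<exists>M. atomic_measure T n M \<and> representing_measure T m f s M"
proof -
  define Y where "Y = {z \<in> Z. w z > 0}"
  have Y: "finite Y" "Y \<subseteq> Z" using Z(1) by (auto simp: Y_def)
  obtain x where x: "bij_betw x {..<card Y} Y"
    using ex_bij_betw_nat_finite[OF Y(1)] atLeast0LessThan by metis
  have xY: "x i \<in> Y" if "i < card Y" for i using x that by (auto simp: bij_betw_def)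
  have xT: "x i \<in> topspace T" if "i < card Y" for i using xY[OF that] Y Z by auto
  have pos: "0 < w (x i)" if "i < card Y" for i using xY[OF that] by (simp add: Y_def)
  have "s j = (\<Sum>i<card Y. w (x i) * f j (x i))" if "j < m" for j
  proof -
    have "s j = (\<Sum>z\<in>Y. w z * f j z)"
      unfolding s[OF that] using Z(1) w by (intro sum.mono_neutral_right) (force simp: Y_def)+
    also have "\<dots> = (\<Sum>i<card Y. w (x i) * f j (x i))"
      by (rule sum.reindex_bij_betw[OF x, symmetric])
    finally show ?thesis .
  qed
  then have "representing_measure T m f s (atoms T (card Y) (\<lambda>i. w (x i)) x)"
    using pos xT by (intro representing_measure_atoms[OF T f]) (auto simp: less_imp_le)
  moreover have "atomic_measure T (card Y) (atoms T (card Y) (\<lambda>i. w (x i)) x)"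
    unfolding atomic_measure_def sets_atoms
    by (intro conjI exI[of _ "\<lambda>i. w (x i)"] exI[of _ x] allI impI ballI pos xT refl
        emeasure_atoms bij_betw_imp_inj_on[OF x])
  ultimately show ?thesis using card_mono[OF Z(1) Y(2)] by blast
qed

text \<open>A non-negative function with vanishing integral vanishes almost everywhere, so almost every point
lies in the finite set of its zeros.\<close>

lemma moments_concentrated_on_zeros:
  assumes T: "t1_space T" and R: "representing_measure T m f s M"
    and nn: "\<And>p. p \<in> topspace T \<Longrightarrow> 0 \<le> (\<Sum>j<m. a j * f j p)"
    and zero: "(\<Sum>j<m. a j * s j) = 0"
    and fin: "finite {p \<in> topspace T. (\<Sum>j<m. a j * f j p) = 0}"
  shows "\<forall>j<m. s j = (\<Sum>p | p \<in> topspace T \<and> (\<Sum>j<m. a j * f j p) = 0. measure M {p} * f j p)"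
proof (intro allI impI)
  fix j assume j: "j < m"
  define Z where "Z = {p \<in> topspace T. (\<Sum>j<m. a j * f j p) = 0}"
  have sets: "sets M = sets (borel_top T)" and compact: "\<And>K. compactin T K \<Longrightarrow> emeasure M K < \<infinity>"
    and int: "\<And>j. j < m \<Longrightarrow> integrable M (f j)" and s: "\<And>j. j < m \<Longrightarrow> s j = integral\<^sup>L M (f j)"
    using R by (auto simp: representing_measure_def radon_measure_def)
  have space: "space M = topspace T" using sets_eq_imp_space_eq[OF sets] by simp
  have int_g: "integrable M (\<lambda>p. \<Sum>j<m. a j * f j p)" using int by (intro Bochner_Integration.integrable_sum) auto
  have "integral\<^sup>L M (\<lambda>p. \<Sum>j<m. a j * f j p) = (\<Sum>j<m. a j * s j)"
    using int s by (subst Bochner_Integration.integral_sum) auto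
  moreover have "AE p in M. 0 \<le> (\<Sum>j<m. a j * f j p)" by (intro AE_I2) (simp add: nn space)
  ultimately have "AE p in M. (\<Sum>j<m. a j * f j p) = 0"
    using integral_nonneg_eq_0_iff_AE[OF int_g] zero by simp
  then have AE: "AE p in M. p \<in> Z"
    using AE_space by eventually_elim (simp add: Z_def space)
  have singl: "{z} \<in> sets M" if "z \<in> Z" for z
    using that singleton_in_sets_borel_top[OF T] by (simp add: sets Z_def)
  have singl_fin: "emeasure M {z} < \<infinity>" if "z \<in> Z" for z
    using that by (intro compact finite_imp_compactin) (auto simp: Z_def)
  have "s j = integral\<^sup>L M (\<lambda>p. \<Sum>z\<in>Z. f j z * indicator {z} p)"
    unfolding s[OF j]
  proof (rule integral_cong_AE)
    show "f j \<in> borel_measurable M" using int[OF j] by simp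
    show "(\<lambda>p. \<Sum>z\<in>Z. f j z * indicator {z} p) \<in> borel_measurable M"
      using singl by (intro borel_measurable_sum borel_measurable_times) auto
    show "AE p in M. f j p = (\<Sum>z\<in>Z. f j z * indicator {z} p)"
      using AE
    proof eventually_elim
      case (elim p)
      have "(\<Sum>z\<in>Z. f j z * indicator {z} p) = (\<Sum>z\<in>Z. if z = p then f j z else 0)"
        by (intro sum.cong) (auto simp: indicator_def)
      then show ?case using elim fin by (simp add: Z_def)
    qed
  qed
  also have "\<dots> = (\<Sum>z\<in>Z. measure M {z} * f j z)"
    using singl singl_fin
    by (subst Bochner_Integration.integral_sum)
      (auto intro!: integrable_mult_right integrable_real_indicator sum.cong simp: mult.commute)
  finally show "s j = (\<Sum>p | p \<in> topspace T \<and> (\<Sum>j<m. a j * f j p) = 0. measure M {p} * f j p)"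
    by (simp add: Z_def)
qed

lemma nonneg_moment:
  assumes R: "representing_measure T m f s M"
    and nn: "\<And>p. p \<in> topspace T \<Longrightarrow> 0 \<le> (\<Sum>j<m. a j * f j p)"
  shows "0 \<le> (\<Sum>j<m. a j * s j)"
proof -
  have sets: "sets M = sets (borel_top T)"
    and int: "\<And>j. j < m \<Longrightarrow> integrable M (f j)" and s: "\<And>j. j < m \<Longrightarrow> s j = integral\<^sup>L M (f j)"
    using R by (auto simp: representing_measure_def radon_measure_def)
  have space: "space M = topspace T" using sets_eq_imp_space_eq[OF sets] by simp
  have "(\<Sum>j<m. a j * s j) = integral\<^sup>L M (\<lambda>p. \<Sum>j<m. a j * f j p)"
    using int s by (subst Bochner_Integration.integral_sum) auto
  also have "0 \<le> \<dots>" by (intro integral_nonneg_AE AE_I2) (simp add: nn space)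
  finally show ?thesis .
qed

lemma caratheodory_number_eqI:
  assumes T: "t1_space T" and f: "\<And>j. j < m \<Longrightarrow> f j \<in> borel_measurable (borel_top T)"
    and upper: "\<And>s M. representing_measure T m f s M \<Longrightarrow> \<exists>Z w. finite Z \<and> Z \<subseteq> topspace T \<and>
      card Z \<le> k \<and> (\<forall>z. 0 \<le> w z) \<and> (\<forall>j<m. s j = (\<Sum>z\<in>Z. w z * f j z))"
    and lower: "\<And>N. (\<And>s. moment_sequence T m f s \<Longrightarrow> \<exists>n\<le>N. \<exists>c x. (\<forall>i<n. 0 < c i \<and> x i \<in> topspace T) \<and>
      (\<forall>j<m. s j = (\<Sum>i<n. c i * f j (x i)))) \<Longrightarrow> k \<le> N"
  shows "caratheodory_number T m f = k"
  unfolding caratheodory_number_def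
proof (rule Least_equality)
  show "\<forall>s. moment_sequence T m f s \<longrightarrow>
      (\<exists>n\<le>k. \<exists>M. atomic_measure T n M \<and> representing_measure T m f s M)"
  proof (intro allI impI)
    fix s assume "moment_sequence T m f s"
    then obtain M where "representing_measure T m f s M" by (auto simp: moment_sequence_def)
    from upper[OF this] obtain Z w where Z: "finite Z" "Z \<subseteq> topspace T" "card Z \<le> k"
      and w: "\<forall>z. 0 \<le> (w z :: real)" "\<forall>j<m. s j = (\<Sum>z\<in>Z. w z * f j z)" by blast
    have "\<exists>n\<le>card Z. \<exists>M. atomic_measure T n M \<and> representing_measure T m f s M"
      using w by (intro exists_atomic_representing_measure[OF T f Z(1,2), where w = w]) auto
    then show "\<exists>n\<le>k. \<exists>M. atomic_measure T n M \<and> representing_measure T m f s M"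
      using Z(3) order_trans by blast
  qed
next
  fix N assume N: "\<forall>s. moment_sequence T m f s \<longrightarrow>
      (\<exists>n\<le>N. \<exists>M. atomic_measure T n M \<and> representing_measure T m f s M)"
  show "k \<le> N"
  proof (rule lower)
    fix s assume "moment_sequence T m f s"
    with N obtain n M where n: "n \<le> N" "atomic_measure T n M" "representing_measure T m f s M" by blast
    obtain c x where "\<And>i. i < n \<Longrightarrow> 0 < c i" "\<And>i. i < n \<Longrightarrow> x i \<in> topspace T"
      "\<And>j. j < m \<Longrightarrow> s j = (\<Sum>i<n. c i * f j (x i))"
      using atomic_representing_measureD[OF n(2,3) f] by blast
    then have "(\<forall>i<n. 0 < c i \<and> x i \<in> topspace T) \<and> (\<forall>j<m. s j = (\<Sum>i<n. c i * f j (x i)))" by blast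
    with n(1) show "\<exists>n\<le>N. \<exists>c x. (\<forall>i<n. 0 < c i \<and> x i \<in> topspace T) \<and>
      (\<forall>j<m. s j = (\<Sum>i<n. c i * f j (x i)))" by blast
  qed
qed

section \<open>The lower bound on the number of atoms\<close>

text \<open>The larger one of the two homogeneous coordinates is absorbed into the weight. The ratio of the
coordinates then lies in \<open>[-1, 1]\<close>, and the new weight is one of the two extreme moments of the atom,
hence bounded by their sum. So an atom is described by a flag and two bounded parameters.\<close>

lemma projective_atom_chart:
  assumes p: "p \<in> proj_line" and c: "0 \<le> (c :: real)"
    and e: "e 0 = 0" "e (m - 1) = 2 * d" "\<And>j. j < m \<Longrightarrow> e j \<le> 2 * d"
  shows "\<exists>fl w t. 0 \<le> w \<and> \<bar>t\<bar> \<le> 1 \<and>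
     w \<le> c * hom_monomials (2 * d) e 0 p + c * hom_monomials (2 * d) e (m - 1) p \<and>
     (\<forall>j<m. c * hom_monomials (2 * d) e j p = w * t ^ (if fl then e j else 2 * d - e j))"
proof -
  obtain x y where xy: "p = (x, y)" by (cases p)
  have nz: "x \<noteq> 0 \<or> y \<noteq> 0" using p by (auto simp: xy proj_line_def)
  have h0: "hom_monomials (2 * d) e 0 p = y ^ (2 * d)" "hom_monomials (2 * d) e (m - 1) p = x ^ (2 * d)"
    using e by (simp_all add: hom_monomials_def xy)
  have nn: "0 \<le> c * x ^ (2 * d)" "0 \<le> c * y ^ (2 * d)" using c by simp_all
  show ?thesis
  proof (cases "\<bar>x\<bar> \<le> \<bar>y\<bar>")
    case True
    with nz have y: "y \<noteq> 0" by auto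
    have "x ^ e j * y ^ (2 * d - e j) = y ^ (2 * d) * (x / y) ^ e j" if "j < m" for j
    proof -
      have "y ^ (2 * d) = y ^ e j * y ^ (2 * d - e j)" using e(3)[OF that] by (simp flip: power_add)
      then show ?thesis using y by (simp add: power_divide)
    qed
    moreover have "\<bar>x / y\<bar> \<le> 1" using True y by simp
    ultimately have "0 \<le> c * y ^ (2 * d) \<and> \<bar>x / y\<bar> \<le> 1 \<and>
        c * y ^ (2 * d) \<le> c * hom_monomials (2 * d) e 0 p + c * hom_monomials (2 * d) e (m - 1) p \<and>
        (\<forall>j<m. c * hom_monomials (2 * d) e j p
          = c * y ^ (2 * d) * (x / y) ^ (if True then e j else 2 * d - e j))"
      using nn unfolding h0 by (simp add: hom_monomials_def xy)
    then show ?thesis by blast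
  next
    case False
    then have x: "x \<noteq> 0" by auto
    have "x ^ e j * y ^ (2 * d - e j) = x ^ (2 * d) * (y / x) ^ (2 * d - e j)" if "j < m" for j
    proof -
      have "x ^ (2 * d) = x ^ e j * x ^ (2 * d - e j)" using e(3)[OF that] by (simp flip: power_add)
      then show ?thesis using x by (simp add: power_divide)
    qed
    moreover have "\<bar>y / x\<bar> \<le> 1" using False x by simp
    ultimately have "0 \<le> c * x ^ (2 * d) \<and> \<bar>y / x\<bar> \<le> 1 \<and>
        c * x ^ (2 * d) \<le> c * hom_monomials (2 * d) e 0 p + c * hom_monomials (2 * d) e (m - 1) p \<and>
        (\<forall>j<m. c * hom_monomials (2 * d) e j p
          = c * x ^ (2 * d) * (y / x) ^ (if False then e j else 2 * d - e j))"
      using nn unfolding h0 by (simp add: hom_monomials_def xy)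
    then show ?thesis by blast
  qed
qed

lemma chart_term_lipschitz:
  fixes w w' t t' :: real
  assumes "0 \<le> w'" "w' \<le> W" "\<bar>t\<bar> \<le> 1" "\<bar>t'\<bar> \<le> 1" "E \<le> D"
  shows "\<bar>w * t ^ E - w' * t' ^ E\<bar> \<le> \<bar>w - w'\<bar> + W * (real D * \<bar>t - t'\<bar>)"
proof -
  have "w * t ^ E - w' * t' ^ E = (w - w') * t ^ E + w' * (t ^ E - t' ^ E)"
    by (simp add: algebra_simps)
  then have "\<bar>w * t ^ E - w' * t' ^ E\<bar> \<le> \<bar>(w - w') * t ^ E\<bar> + \<bar>w' * (t ^ E - t' ^ E)\<bar>"
    by (metis abs_triangle_ineq)
  also have "\<bar>(w - w') * t ^ E\<bar> \<le> \<bar>w - w'\<bar> * 1"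
    unfolding abs_mult using assms(3) by (intro mult_left_mono) (auto simp: power_abs power_le_one)
  also have "\<bar>w' * (t ^ E - t' ^ E)\<bar> \<le> W * (real D * \<bar>t - t'\<bar>)"
  proof -
    have "\<bar>t ^ E - t' ^ E\<bar> \<le> real E * \<bar>t - t'\<bar>"
      using norm_power_diff[of t t' E] assms(3,4) by simp
    also have "\<dots> \<le> real D * \<bar>t - t'\<bar>" using assms(5) by (intro mult_right_mono) auto
    finally show ?thesis
      unfolding abs_mult using assms(1,2) by (intro mult_mono) auto
  qed
  finally show ?thesis by simp
qed

lemma floor_eq_imp_close:
  fixes a b :: real
  assumes "\<lfloor>q * a\<rfloor> = \<lfloor>q * b\<rfloor>" "q > 0"
  shows "\<bar>a - b\<bar> \<le> 1 / q"
proof -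
  have "\<bar>q * a - q * b\<bar> \<le> 1" using assms(1) by linarith
  then have "q * \<bar>a - b\<bar> \<le> 1" using assms(2) by (simp add: abs_mult flip: right_diff_distrib)
  then show ?thesis using assms(2) by (simp add: field_simps)
qed

text \<open>Pigeonhole principle. The sources are the measures with masses in \<open>{0, 1/R, .., (R-1)/R}\<close> at the
points \<open>2\<^sup>l\<close>; they are encoded by the discretised chart data of \<open>N\<close> atoms. The points \<open>2\<^sup>l\<close> make all
moments integer multiples of \<open>1 / R\<close>, so moments that are close are equal. Moreover the \<open>j\<close>-th moment
is the value at \<open>2\<close> to the power \<open>e j\<close> of the polynomial with the masses as coefficients, so a
polynomial of degree less than \<open>m\<close> is tested at \<open>m\<close> distinct points, and the masses are determined
by the moments.\<close>

lemma few_atoms_insufficient: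
  fixes e :: "nat \<Rightarrow> nat"
  assumes m_pos: "m \<ge> 1" and strict: "strict_mono_on {..<m} e"
    and e0: "e 0 = 0" and e_last: "e (m - 1) = 2 * d"
    and rep: "\<And>\<alpha>. (\<And>l. 0 \<le> \<alpha> l) \<Longrightarrow> \<exists>n\<le>N. \<exists>c p. (\<forall>i<n. 0 < c i \<and> p i \<in> proj_line) \<and>
      (\<forall>j<m. (\<Sum>l<m. \<alpha> l * (2 ^ l) ^ e j) = (\<Sum>i<n. c i * hom_monomials (2 * d) e j (p i)))"
  shows "m \<le> 2 * N"
proof (rule ccontr)
  assume "\<not> m \<le> 2 * N"
  then have m: "2 * N + 1 \<le> m" by simp
  have e_le: "e j \<le> 2 * d" if "j < m" for j
    using strict_mono_onD[OF strict, of j "m - 1"] that e_last m_pos by (cases "j = m - 1") force+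
  define E where "E fl j = (if fl then e j else 2 * d - e j)" for fl j
  \<comment> \<open>A bound for all moments of the sources; two of them bound a weight by \<open>W\<close>.\<close>
  define W0 :: nat where "W0 = (\<Sum>l<m. (2 ^ l) ^ (2 * d))"
  define W where "W = 2 * W0"
  have moment_le: "(\<Sum>l<m. \<alpha> l * (2 ^ l) ^ e j) \<le> real W0"
    if "\<And>l. 0 \<le> \<alpha> l \<and> \<alpha> l \<le> 1" "j < m" for \<alpha> :: "nat \<Rightarrow> real" and j
  proof -
    have "(\<Sum>l<m. \<alpha> l * (2 ^ l) ^ e j) \<le> (\<Sum>l<m. 1 * (2 ^ l) ^ (2 * d))"
      using that(1) e_le[OF that(2)] by (intro sum_mono mult_mono power_increasing) auto
    then show ?thesis by (simp add: W0_def)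
  qed
  have normal_form: "\<exists>fl w t. (\<forall>i<N. 0 \<le> w i \<and> w i \<le> real W \<and> \<bar>t i\<bar> \<le> 1) \<and>
      (\<forall>j<m. (\<Sum>l<m. \<alpha> l * (2 ^ l) ^ e j) = (\<Sum>i<N. w i * t i ^ E (fl i) j))"
    if \<alpha>: "\<And>l. 0 \<le> \<alpha> l \<and> \<alpha> l \<le> 1" for \<alpha> :: "nat \<Rightarrow> real"
  proof -
    obtain n c p where n: "n \<le> N" and cp: "\<And>i. i < n \<Longrightarrow> 0 < c i \<and> p i \<in> proj_line"
      and s: "\<And>j. j < m \<Longrightarrow> (\<Sum>l<m. \<alpha> l * (2 ^ l) ^ e j) = (\<Sum>i<n. c i * hom_monomials (2 * d) e j (p i))"
      using rep[of \<alpha>] \<alpha> by blast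
    have "\<exists>fl w t. 0 \<le> w \<and> \<bar>t\<bar> \<le> 1 \<and>
       w \<le> c i * hom_monomials (2 * d) e 0 (p i) + c i * hom_monomials (2 * d) e (m - 1) (p i) \<and>
       (\<forall>j<m. c i * hom_monomials (2 * d) e j (p i) = w * t ^ E fl j)" if "i < n" for i
      unfolding E_def using cp[OF that] by (intro projective_atom_chart[OF _ _ e0 e_last e_le]) auto
    then obtain fl w t where chart: "\<And>i. i < n \<Longrightarrow> 0 \<le> w i \<and> \<bar>t i\<bar> \<le> 1 \<and>
       w i \<le> c i * hom_monomials (2 * d) e 0 (p i) + c i * hom_monomials (2 * d) e (m - 1) (p i) \<and>
       (\<forall>j<m. c i * hom_monomials (2 * d) e j (p i) = w i * t i ^ E (fl i) j)"
      by metis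
    have nonneg: "0 \<le> c i * hom_monomials (2 * d) e 0 (p i)"
        "0 \<le> c i * hom_monomials (2 * d) e (m - 1) (p i)" if "i < n" for i
      using cp[OF that] e0 e_last by (auto simp: hom_monomials_def case_prod_beta)
    have w_le: "w i \<le> real W" if "i < n" for i
    proof -
      have "c i * hom_monomials (2 * d) e 0 (p i) \<le> (\<Sum>i<n. c i * hom_monomials (2 * d) e 0 (p i))"
        using that nonneg by (intro member_le_sum) auto
      moreover have "c i * hom_monomials (2 * d) e (m - 1) (p i)
          \<le> (\<Sum>i<n. c i * hom_monomials (2 * d) e (m - 1) (p i))"
        using that nonneg by (intro member_le_sum) auto
      moreover have "(\<Sum>i<n. c i * hom_monomials (2 * d) e 0 (p i)) \<le> real W0"
        using m_pos by (subst s[symmetric]) (auto intro!: moment_le[OF \<alpha>])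
      moreover have "(\<Sum>i<n. c i * hom_monomials (2 * d) e (m - 1) (p i)) \<le> real W0"
        using m_pos by (subst s[symmetric]) (auto intro!: moment_le[OF \<alpha>])
      ultimately show ?thesis using chart[OF that] by (simp add: W_def)
    qed
    \<comment> \<open>Missing atoms are filled up with weight \<open>0\<close>, so that all codes have length \<open>N\<close>.\<close>
    define w' where "w' i = (if i < n then w i else 0)" for i
    define t' where "t' i = (if i < n then t i else 0)" for i
    have "(\<Sum>l<m. \<alpha> l * (2 ^ l) ^ e j) = (\<Sum>i<N. w' i * t' i ^ E (fl i) j)" if "j < m" for j
    proof -
      have "(\<Sum>i<n. c i * hom_monomials (2 * d) e j (p i)) = (\<Sum>i<n. w' i * t' i ^ E (fl i) j)"
        using chart that by (intro sum.cong) (auto simp: w'_def t'_def)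
      also have "\<dots> = (\<Sum>i<N. w' i * t' i ^ E (fl i) j)"
        using n by (intro sum.mono_neutral_left) (auto simp: w'_def)
      finally show ?thesis using s[OF that] by simp
    qed
    moreover have "\<forall>i<N. 0 \<le> w' i \<and> w' i \<le> real W \<and> \<bar>t' i\<bar> \<le> 1"
      using chart w_le by (auto simp: w'_def t'_def)
    ultimately show ?thesis by blast
  qed
  \<comment> \<open>With step \<open>1 / (R * q)\<close> equal codes force moments to differ by less than \<open>1 / R\<close>.\<close>
  define q :: nat where "q = N * (1 + W * (2 * d)) + 1"
  have q: "q > 0" by (simp add: q_def)
  define C :: nat where "C = 2 * (W + 1) * 3"
  have bound: "R ^ m \<le> (C * q ^ 2 * R ^ 2) ^ N" if R: "R \<ge> 1" for R :: nat
  proof -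
    define Q where "Q = R * q"
    have Q: "Q \<ge> 1" using R by (simp add: Q_def q_def)
    define A where "A = ({..<m} \<rightarrow>\<^sub>E {..<R})"
    define B where "B = ({..<N} \<rightarrow>\<^sub>E (UNIV :: bool set) \<times> {0..int (Q * W)} \<times> {- int Q..int Q})"
    define s where "s \<alpha> j = (\<Sum>l<m. (real (\<alpha> l) / real R) * (2 ^ l) ^ e j)" for \<alpha> :: "nat \<Rightarrow> nat" and j
    define chart_data where "chart_data \<alpha> c \<longleftrightarrow> (case c of (fl, w, t) \<Rightarrow>
      (\<forall>i<N. 0 \<le> w i \<and> w i \<le> real W \<and> \<bar>t i\<bar> \<le> 1) \<and>
      (\<forall>j<m. s \<alpha> j = (\<Sum>i<N. w i * t i ^ E (fl i) j)))" for \<alpha> c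
    have chart_data: "\<exists>c. chart_data \<alpha> c" if "\<alpha> \<in> A" for \<alpha>
    proof -
      define \<beta> where "\<beta> l = (if l < m then real (\<alpha> l) / real R else 0)" for l
      have s\<beta>: "s \<alpha> j = (\<Sum>l<m. \<beta> l * (2 ^ l) ^ e j)" for j
        unfolding s_def by (intro sum.cong) (auto simp: \<beta>_def)
      have "0 \<le> \<beta> l \<and> \<beta> l \<le> 1" for l
      proof (cases "l < m")
        case True
        then have "\<alpha> l < R" using that by (auto simp: A_def PiE_iff)
        then show ?thesis using R by (simp add: \<beta>_def)
      qed (simp add: \<beta>_def)
      then have "\<exists>fl w t. chart_data \<alpha> (fl, w, t)" unfolding chart_data_def s\<beta> prod.case by (rule normal_form)
      then show ?thesis by blast
    qed
    define g where "g \<alpha> = (SOME c. chart_data \<alpha> c)" for \<alpha>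
    define fl where "fl \<alpha> = fst (g \<alpha>)" for \<alpha>
    define w where "w \<alpha> = fst (snd (g \<alpha>))" for \<alpha>
    define t where "t \<alpha> = snd (snd (g \<alpha>))" for \<alpha>
    have g: "chart_data \<alpha> (fl \<alpha>, w \<alpha>, t \<alpha>)" if "\<alpha> \<in> A" for \<alpha>
      using someI_ex[OF chart_data[OF that]] by (simp add: fl_def w_def t_def g_def)
    have wt: "0 \<le> w \<alpha> i \<and> w \<alpha> i \<le> real W \<and> \<bar>t \<alpha> i\<bar> \<le> 1" if "\<alpha> \<in> A" "i < N" for \<alpha> i
      using g[OF that(1)] that(2) by (simp add: chart_data_def)
    have s: "s \<alpha> j = (\<Sum>i<N. w \<alpha> i * t \<alpha> i ^ E (fl \<alpha> i) j)" if "\<alpha> \<in> A" "j < m" for \<alpha> j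
      using g[OF that(1)] that(2) by (simp add: chart_data_def)
    define F where "F \<alpha> = (\<lambda>i\<in>{..<N}. (fl \<alpha> i, \<lfloor>real Q * w \<alpha> i\<rfloor>, \<lfloor>real Q * t \<alpha> i\<rfloor>))" for \<alpha>
    have "F ` A \<subseteq> B"
    proof (rule image_subsetI)
      fix \<alpha> assume \<alpha>: "\<alpha> \<in> A"
      have "0 \<le> \<lfloor>real Q * w \<alpha> i\<rfloor> \<and> \<lfloor>real Q * w \<alpha> i\<rfloor> \<le> int (Q * W) \<and>
          - int Q \<le> \<lfloor>real Q * t \<alpha> i\<rfloor> \<and> \<lfloor>real Q * t \<alpha> i\<rfloor> \<le> int Q" if "i < N" for i
      proof -
        have "0 \<le> real Q * w \<alpha> i" using wt[OF \<alpha> that] by simp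
        moreover have "real Q * w \<alpha> i \<le> real Q * real W"
          using wt[OF \<alpha> that] by (intro mult_left_mono) auto
        moreover have "\<bar>real Q * t \<alpha> i\<bar> \<le> real Q * 1"
          unfolding abs_mult using wt[OF \<alpha> that] by (intro mult_mono) auto
        ultimately show ?thesis by (simp add: floor_le_iff le_floor_iff abs_le_iff)
      qed
      then show "F \<alpha> \<in> B" by (auto simp: F_def B_def)
    qed
    moreover have "inj_on F A"
    proof (rule inj_onI)
      fix \<alpha> \<beta> assume \<alpha>: "\<alpha> \<in> A" and \<beta>: "\<beta> \<in> A" and F: "F \<alpha> = F \<beta>"
      have same: "fl \<alpha> i = fl \<beta> i \<and> \<bar>w \<alpha> i - w \<beta> i\<bar> \<le> 1 / real Q \<and> \<bar>t \<alpha> i - t \<beta> i\<bar> \<le> 1 / real Q"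
        if "i < N" for i
      proof -
        have "F \<alpha> i = F \<beta> i" by (simp add: F)
        then have "fl \<alpha> i = fl \<beta> i" "\<lfloor>real Q * w \<alpha> i\<rfloor> = \<lfloor>real Q * w \<beta> i\<rfloor>"
            "\<lfloor>real Q * t \<alpha> i\<rfloor> = \<lfloor>real Q * t \<beta> i\<rfloor>"
          using that by (simp_all add: F_def)
        then show ?thesis using Q by (auto intro: floor_eq_imp_close)
      qed
      have moments: "(\<Sum>l<m. int (\<alpha> l) * (2 ^ l) ^ e j) = (\<Sum>l<m. int (\<beta> l) * (2 ^ l) ^ e j)"
        if j: "j < m" for j
      proof -
        have "\<bar>w \<alpha> i * t \<alpha> i ^ E (fl \<alpha> i) j - w \<beta> i * t \<beta> i ^ E (fl \<beta> i) j\<bar>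
            \<le> (1 + real W * real (2 * d)) / real Q" if i: "i < N" for i
        proof -
          have "E (fl \<alpha> i) j \<le> 2 * d" using e_le[OF j] by (simp add: E_def)
          then have "\<bar>w \<alpha> i * t \<alpha> i ^ E (fl \<alpha> i) j - w \<beta> i * t \<beta> i ^ E (fl \<alpha> i) j\<bar>
              \<le> \<bar>w \<alpha> i - w \<beta> i\<bar> + real W * (real (2 * d) * \<bar>t \<alpha> i - t \<beta> i\<bar>)"
            using wt[OF \<alpha> i] wt[OF \<beta> i] by (intro chart_term_lipschitz) auto
          also have "\<dots> \<le> 1 / real Q + real W * (real (2 * d) * (1 / real Q))"
            using same[OF i] by (intro add_mono mult_left_mono) auto
          finally show ?thesis using same[OF i] by (simp add: add_divide_distrib)
        qed
        then have "\<bar>s \<alpha> j - s \<beta> j\<bar> \<le> (\<Sum>i<N. (1 + real W * real (2 * d)) / real Q)"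
          unfolding s[OF \<alpha> j] s[OF \<beta> j] sum_subtractf[symmetric]
          by (intro order_trans[OF sum_abs] sum_mono) auto
        also have "\<dots> = real (N * (1 + W * (2 * d))) / real Q"
          by (simp add: algebra_simps)
        also have "\<dots> < real q / real Q" using Q by (intro divide_strict_right_mono) (auto simp: q_def)
        also have "real q / real Q = 1 / real R" using q by (simp add: Q_def)
        finally have "real R * \<bar>s \<alpha> j - s \<beta> j\<bar> < 1" using R by (simp add: field_simps)
        then have "\<bar>real R * s \<alpha> j - real R * s \<beta> j\<bar> < 1"
          by (simp add: abs_mult flip: right_diff_distrib)
        moreover have Rs: "real R * s \<gamma> j = real_of_int (\<Sum>l<m. int (\<gamma> l) * (2 ^ l) ^ e j)" for \<gamma>
          unfolding s_def sum_distrib_left using R by simp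
        ultimately show ?thesis using Rs[of \<alpha>] Rs[of \<beta>] by linarith
      qed
      define P where "P = (\<Sum>l<m. Polynomial.monom (real (\<alpha> l) - real (\<beta> l)) l)"
      have coeffP: "coeff P l = (if l < m then real (\<alpha> l) - real (\<beta> l) else 0)" for l
        by (simp add: P_def coeff_sum)
      have rootsP: "poly P (2 ^ e j) = 0" if "j < m" for j
      proof -
        have "real_of_int (\<Sum>l<m. int (\<alpha> l) * (2 ^ l) ^ e j) = real_of_int (\<Sum>l<m. int (\<beta> l) * (2 ^ l) ^ e j)"
          using moments[OF that] by simp
        moreover have "poly P (2 ^ e j) = (\<Sum>l<m. real (\<alpha> l) * (2 ^ l) ^ e j) - (\<Sum>l<m. real (\<beta> l) * (2 ^ l) ^ e j)"
          by (simp add: P_def poly_sum poly_monom left_diff_distrib sum_subtractf mult.commute flip: power_mult)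
        ultimately show ?thesis by simp
      qed
      have "P = 0"
      proof (rule ccontr)
        assume P: "P \<noteq> 0"
        have "inj_on (\<lambda>j. 2 ^ e j :: real) {..<m}"
          using strict_mono_on_imp_inj_on[OF strict] by (simp add: inj_on_def)
        then have "m = card ((\<lambda>j. 2 ^ e j :: real) ` {..<m})" by (simp add: card_image)
        also have "\<dots> \<le> card {x. poly P x = 0}"
          using rootsP poly_roots_finite[OF P] by (intro card_mono) auto
        also have "\<dots> \<le> degree P" by (rule card_poly_roots_bound[OF P])
        also have "degree P \<le> m - 1" by (intro degree_le) (auto simp: coeffP)
        finally show False using m_pos by simp
      qed
      then have "\<alpha> l = \<beta> l" if "l < m" for l using coeffP[of l] that by simp
      then show "\<alpha> = \<beta>" using \<alpha> \<beta> unfolding A_def by (intro PiE_ext) auto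
    qed
    moreover have "finite B" unfolding B_def by (intro finite_PiE) auto
    ultimately have "card A \<le> card B" by (intro card_inj_on_le)
    moreover have "card A = R ^ m" by (simp add: A_def card_PiE)
    moreover have "card B = (2 * ((Q * W + 1) * (2 * Q + 1))) ^ N"
    proof -
      have "card {0..int (Q * W)} = Q * W + 1" "card {- int Q..int Q} = 2 * Q + 1"
        unfolding card_atLeastAtMost_int by arith+
      then show ?thesis by (simp only: B_def card_PiE card_cartesian_product finite_lessThan) simp
    qed
    moreover have "2 * ((Q * W + 1) * (2 * Q + 1)) \<le> 2 * ((Q * (W + 1)) * (3 * Q))"
      using Q by (intro mult_mono) auto
    then have "(2 * ((Q * W + 1) * (2 * Q + 1))) ^ N \<le> (C * q ^ 2 * R ^ 2) ^ N"
    proof (rule power_mono[OF order_trans])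
      show "2 * ((Q * (W + 1)) * (3 * Q)) \<le> C * q ^ 2 * R ^ 2"
        by (simp add: C_def Q_def power2_eq_square algebra_simps)
    qed simp
    ultimately show ?thesis by simp
  qed
  \<comment> \<open>Neither \<open>C\<close> nor \<open>q\<close> depends on \<open>R\<close>; the choice \<open>R = K + 1\<close> violates the bound.\<close>
  define K where "K = (C * q ^ 2) ^ N"
  have "(K + 1) ^ (2 * N + 1) \<le> (K + 1) ^ m" using m by (intro power_increasing) auto
  also have "\<dots> \<le> (C * q ^ 2 * (K + 1) ^ 2) ^ N" by (rule bound) simp
  also have "\<dots> = K * (K + 1) ^ (2 * N)" by (simp add: K_def power_mult_distrib flip: power_mult)
  finally have "(K + 1) * (K + 1) ^ (2 * N) \<le> K * (K + 1) ^ (2 * N)" by simp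
  then show False by simp
qed

section \<open>The projective line\<close>

lemma proj_line_cover: "p \<in> sphere 0 1 \<longleftrightarrow> p \<in> proj_line \<or> - p \<in> proj_line"
  by (cases p) (auto simp: proj_line_def norm_Pair power2_eq_1_iff)

text \<open>An open set of the plane that is invariant under the antipodal map cuts out an open set of representatives.\<close>

lemma openin_proj_topologyI:
  assumes U: "U \<subseteq> proj_line" and V: "open V" and UV: "\<And>p. p \<in> proj_line \<Longrightarrow> p \<in> U \<longleftrightarrow> p \<in> V"
    and sym: "\<And>p. p \<in> V \<longleftrightarrow> - p \<in> V"
  shows "openin proj_topology U"
proof -
  have "p \<in> U \<union> uminus ` U \<longleftrightarrow> p \<in> sphere 0 1 \<inter> V" for p
  proof -
    have "p \<in> uminus ` U \<longleftrightarrow> - p \<in> U" by (metis add.inverse_inverse imageE imageI)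
    then show ?thesis using U UV[of p] UV[of "- p"] sym[of p] proj_line_cover[of p] by blast
  qed
  then have "U \<union> uminus ` U = sphere 0 1 \<inter> V" by blast
  then show ?thesis using U V unfolding openin_proj_topology openin_open by blast
qed

lemma t1_space_proj_topology: "t1_space proj_topology"
  unfolding t1_space_closedin_singleton
proof
  fix z assume z: "z \<in> topspace proj_topology"
  then have zp: "z \<in> proj_line" by (simp add: topspace_proj_topology)
  have neg: "- z \<notin> proj_line" using zp by (auto simp: proj_line_def)
  have "openin proj_topology (proj_line - {z})"
  proof (rule openin_proj_topologyI)
    show "open (- {z, - z})" by (intro open_Compl finite_imp_closed) simp
    show "p \<in> proj_line - {z} \<longleftrightarrow> p \<in> - {z, - z}" if "p \<in> proj_line" for p
      using that neg by blast
    have "- p = z \<longleftrightarrow> p = - z" for p by (cases p, cases z) auto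
    then show "p \<in> - {z, - z} \<longleftrightarrow> - p \<in> - {z, - z}" for p by simp blast
  qed blast
  then show "closedin proj_topology {z}" using zp by (simp add: closedin_def topspace_proj_topology)
qed

text \<open>The total degree is even, so the form takes equal values at antipodal points and is continuous on
the quotient.\<close>

lemma hom_monomials_measurable:
  assumes "e j \<le> 2 * d"
  shows "hom_monomials (2 * d) e j \<in> borel_measurable (borel_top proj_topology)"
proof (rule borel_measurableI)
  fix S :: "real set" assume S: "open S"
  have hm: "hom_monomials (2 * d) e j = (\<lambda>p. fst p ^ e j * snd p ^ (2 * d - e j))"
    by (auto simp: hom_monomials_def)
  have "openin proj_topology (hom_monomials (2 * d) e j -` S \<inter> proj_line)"
  proof (rule openin_proj_topologyI)
    show "open (hom_monomials (2 * d) e j -` S)"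
      unfolding hm by (intro open_vimage[OF S] continuous_intros)
    fix p
    have "hom_monomials (2 * d) e j (- p) = (- 1) ^ (e j + (2 * d - e j)) * hom_monomials (2 * d) e j p"
      unfolding hm by (simp add: power_add power_minus[of "fst p"] power_minus[of "snd p"])
    then have "hom_monomials (2 * d) e j (- p) = hom_monomials (2 * d) e j p" using assms by simp
    then show "p \<in> hom_monomials (2 * d) e j -` S \<longleftrightarrow> - p \<in> hom_monomials (2 * d) e j -` S" by simp
  qed auto
  then show "hom_monomials (2 * d) e j -` S \<inter> space (borel_top proj_topology) \<in> sets (borel_top proj_topology)"
    by (simp add: openin_in_sets_borel_top topspace_proj_topology)
qed

lemma monomials_measurable: "monomials e j \<in> borel_measurable (borel_top euclidean)"
proof (rule borel_measurableI)
  fix S :: "real set" assume S: "open S"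
  have "open (monomials e j -` S)"
    unfolding monomials_def by (intro open_vimage[OF S] continuous_intros)
  then show "monomials e j -` S \<inter> space (borel_top euclidean) \<in> sets (borel_top euclidean)"
    by (simp add: openin_in_sets_borel_top)
qed

lemma t1_space_euclidean_real: "t1_space (euclidean :: real topology)"
  by (simp add: t1_space_closedin_singleton)

text \<open>The representative of the line through \<open>(t, 1)\<close>; the sign makes its first non-vanishing coordinate
positive.\<close>

definition proj_point :: "real \<Rightarrow> real \<times> real" where
  "proj_point t = (let r = (if t < 0 then - 1 else 1) / sqrt (1 + t\<^sup>2) in (t * r, r))"

lemma one_plus_square_pos: "0 < 1 + t\<^sup>2" for t :: real
  by (simp add: add_pos_nonneg)

lemma proj_point_in_proj_line: "proj_point t \<in> proj_line"
proof -
  have s: "sqrt (1 + t\<^sup>2) > 0" using one_plus_square_pos by simp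
  have "(t * (c / sqrt (1 + t\<^sup>2)))\<^sup>2 + (c / sqrt (1 + t\<^sup>2))\<^sup>2 = 1" if "c\<^sup>2 = 1" for c
  proof -
    have "(t * (c / sqrt (1 + t\<^sup>2)))\<^sup>2 + (c / sqrt (1 + t\<^sup>2))\<^sup>2 = (t\<^sup>2 + 1) / (1 + t\<^sup>2)"
      using one_plus_square_pos[of t] that
      by (simp add: power_mult_distrib power_divide add_divide_distrib)
    then show ?thesis using one_plus_square_pos[of t] by (simp add: add.commute)
  qed
  from this[of "if t < 0 then - 1 else 1"] show ?thesis
    using s by (auto simp: proj_point_def proj_line_def Let_def norm_Pair divide_simps mult_less_0_iff zero_less_mult_iff)
qed

lemma proj_point_ratio: "fst (proj_point t) / snd (proj_point t) = t"
  using one_plus_square_pos[of t] by (simp add: proj_point_def Let_def)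

text \<open>On the affine chart an atom of the homogeneous family is a positive multiple of an atom of the
inhomogeneous one.\<close>

lemma hom_monomials_proj_point:
  assumes "e j \<le> 2 * d"
  shows "(1 + t\<^sup>2) ^ d * hom_monomials (2 * d) e j (proj_point t) = t ^ e j"
proof -
  define r where "r = (if t < 0 then - 1 else 1) / sqrt (1 + t\<^sup>2)"
  have "r\<^sup>2 = 1 / (1 + t\<^sup>2)" using one_plus_square_pos[of t] by (simp add: r_def power_divide)
  then have r: "(1 + t\<^sup>2) ^ d * r ^ (2 * d) = 1"
    using one_plus_square_pos[of t] by (simp add: power_mult power_divide)
  have "hom_monomials (2 * d) e j (proj_point t) = t ^ e j * r ^ (e j + (2 * d - e j))"
    by (simp add: hom_monomials_def proj_point_def r_def[symmetric] power_mult_distrib power_add)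
  also have "e j + (2 * d - e j) = 2 * d" using assms by simp
  finally show ?thesis using r by (simp add: mult.left_commute)
qed

lemma proj_line_cases:
  assumes "p \<in> proj_line"
  shows "p = (1, 0) \<or> snd p \<noteq> 0 \<and> p = proj_point (fst p / snd p)"
proof -
  obtain x y where p: "p = (x, y)" by (cases p)
  have norm: "x\<^sup>2 + y\<^sup>2 = 1" and sgn: "x > 0 \<or> x = 0 \<and> y > 0"
    using assms by (auto simp: p proj_line_def norm_Pair)
  show ?thesis
  proof (cases "y = 0")
    case True
    then show ?thesis using norm sgn by (auto simp: p power2_eq_1_iff)
  next
    case False
    have "1 + (x / y)\<^sup>2 = 1 / y\<^sup>2" using norm False by (simp add: field_simps)
    then have "sqrt (1 + (x / y)\<^sup>2) = 1 / \<bar>y\<bar>" by (simp add: real_sqrt_divide)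
    moreover have "x / y < 0 \<longleftrightarrow> y < 0" using sgn False by (auto simp: divide_less_0_iff)
    ultimately show ?thesis using False by (auto simp: p proj_point_def Let_def)
  qed
qed

section \<open>The Caratheodory numbers\<close>

context sparse_monomials
begin

lemma leading_coeff_nonneg:
  assumes nn: "\<And>x. 0 \<le> pol a x"
  shows "0 \<le> a (m - 1)"
proof (rule ccontr)
  assume "\<not> 0 \<le> a (m - 1)"
  then have neg: "a (m - 1) < 0" by simp
  define A where "A = (\<Sum>j<m. \<bar>a j\<bar>)"
  define x where "x = max 1 ((A + 1) / - a (m - 1))"
  have x: "1 \<le> x" "A + 1 \<le> - a (m - 1) * x"
  proof -
    have "(A + 1) / - a (m - 1) \<le> x" by (simp add: x_def)
    moreover have "0 < - a (m - 1)" using neg by simp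
    ultimately have "A + 1 \<le> x * - a (m - 1)" by (simp only: pos_divide_le_eq)
    then show "A + 1 \<le> - a (m - 1) * x" by (simp only: mult.commute)
  qed (simp add: x_def)
  have X: "0 < x ^ (2 * d)" using x(1) by simp
  have "(- a (m - 1) * x) * x ^ (2 * d) \<le> \<bar>pol a x - a (m - 1) * x ^ (2 * d)\<bar> * \<bar>x\<bar>"
  proof -
    have "- a (m - 1) * x ^ (2 * d) \<le> \<bar>pol a x - a (m - 1) * x ^ (2 * d)\<bar>" using nn[of x] by simp
    then have "(- a (m - 1) * x ^ (2 * d)) * x \<le> \<bar>pol a x - a (m - 1) * x ^ (2 * d)\<bar> * x"
      using x(1) by (intro mult_right_mono) auto
    then show ?thesis using x(1) by (simp add: mult_ac)
  qed
  also have "\<dots> \<le> A * x ^ (2 * d)" unfolding A_def using x(1) by (intro leading_term_dominates) auto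
  finally have "- a (m - 1) * x \<le> A" using X by (rule mult_right_le_imp_le)
  with x(2) show False by simp
qed

lemma form_at_infinity: "(\<Sum>j<m. a j * hom_monomials (2 * d) e j (1, 0)) = a (m - 1)"
proof -
  have "(\<Sum>j<m. a j * hom_monomials (2 * d) e j (1, 0)) = (\<Sum>j<m. if j = m - 1 then a j else 0)"
  proof (intro sum.cong refl)
    fix j assume "j \<in> {..<m}"
    then show "a j * hom_monomials (2 * d) e j (1, 0) = (if j = m - 1 then a j else 0)"
      using e_less[of j] e_last by (cases "j = m - 1") (auto simp: hom_monomials_def)
  qed
  then show ?thesis using m_pos by simp
qed

lemma form_at_proj_point:
  "(1 + t\<^sup>2) ^ d * (\<Sum>j<m. a j * hom_monomials (2 * d) e j (proj_point t)) = pol a t"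
proof -
  have "(1 + t\<^sup>2) ^ d * (\<Sum>j<m. a j * hom_monomials (2 * d) e j (proj_point t))
      = (\<Sum>j<m. a j * ((1 + t\<^sup>2) ^ d * hom_monomials (2 * d) e j (proj_point t)))"
    by (simp add: sum_distrib_left mult.left_commute)
  also have "\<dots> = (\<Sum>j<m. a j * t ^ e j)"
    by (intro sum.cong) (auto simp: hom_monomials_proj_point e_le)
  finally show ?thesis by (simp add: poly_span_poly)
qed

lemma form_nonneg:
  assumes nn: "\<And>x. 0 \<le> pol a x" and p: "p \<in> proj_line"
  shows "0 \<le> (\<Sum>j<m. a j * hom_monomials (2 * d) e j p)"
  using proj_line_cases[OF p]
proof
  assume "p = (1, 0)"
  then show ?thesis by (simp only: form_at_infinity leading_coeff_nonneg[OF nn])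
next
  assume *: "snd p \<noteq> 0 \<and> p = proj_point (fst p / snd p)"
  define t where "t = fst p / snd p"
  have "0 \<le> (1 + t\<^sup>2) ^ d * (\<Sum>j<m. a j * hom_monomials (2 * d) e j (proj_point t))"
    unfolding form_at_proj_point by (rule nn)
  moreover have "0 < (1 + t\<^sup>2) ^ d" using one_plus_square_pos[of t] by (rule zero_less_power)
  ultimately have "0 \<le> (\<Sum>j<m. a j * hom_monomials (2 * d) e j (proj_point t))"
    by (meson mult_pos_neg not_le)
  then show ?thesis using * by (simp add: t_def)
qed

text \<open>The forms have at most one zero more than the polynomials, namely the point at infinity.\<close>

lemma form_zeros:
  "{p \<in> proj_line. (\<Sum>j<m. a j * hom_monomials (2 * d) e j p) = 0}
     \<subseteq> insert (1, 0) (proj_point ` {x. pol a x = 0})"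
proof
  fix p assume p: "p \<in> {p \<in> proj_line. (\<Sum>j<m. a j * hom_monomials (2 * d) e j p) = 0}"
  then have "p = (1, 0) \<or> p = proj_point (fst p / snd p)" using proj_line_cases[of p] by auto
  then show "p \<in> insert (1, 0) (proj_point ` {x. pol a x = 0})"
  proof
    assume eq: "p = proj_point (fst p / snd p)"
    then have "pol a (fst p / snd p) = 0"
      using p form_at_proj_point[of "fst p / snd p" a] by simp
    with eq show ?thesis by blast
  qed simp
qed

lemma form_measurable:
  "j < m \<Longrightarrow> hom_monomials (2 * d) e j \<in> borel_measurable (borel_top proj_topology)"
  by (rule hom_monomials_measurable) (rule e_le)

text \<open>Both families are treated together: the sources are measures on the line, the competing atoms may
lie anywhere on the projective line.\<close>

lemma lower_bound_from_real_atoms: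
  assumes k: "2 * k \<le> m + 1"
    and rep: "\<And>\<alpha>. (\<And>l. 0 \<le> \<alpha> l) \<Longrightarrow> \<exists>n\<le>N. \<exists>c p. (\<forall>i<n. 0 < c i \<and> p i \<in> proj_line) \<and>
      (\<forall>j<m. (\<Sum>l<m. \<alpha> l * (2 ^ l) ^ e j) = (\<Sum>i<n. c i * hom_monomials (2 * d) e j (p i)))"
  shows "k \<le> N"
proof -
  have "m \<le> 2 * N" by (rule few_atoms_insufficient[OF m_pos strict e_first e_last rep])
  with k show ?thesis by linarith
qed

lemma caratheodory_number_monomials:
  assumes k: "2 * k \<le> m + 1"
  shows "caratheodory_number euclidean m (monomials e) = k"
proof (rule caratheodory_number_eqI[OF t1_space_euclidean_real monomials_measurable])
  fix s M assume R: "representing_measure euclidean m (monomials e) s M"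
  have pol: "(\<Sum>j<m. a j * monomials e j x) = pol a x" for a x
    by (simp add: poly_span_poly monomials_def)
  show "\<exists>Z w. finite Z \<and> Z \<subseteq> topspace euclidean \<and> card Z \<le> k \<and> (\<forall>z. 0 \<le> w z) \<and>
      (\<forall>j<m. s j = (\<Sum>z\<in>Z. w z * monomials e j z))"
  proof (cases "\<exists>a. (\<forall>x. 0 \<le> pol a x) \<and> (\<exists>j<m. a j \<noteq> 0) \<and> (\<Sum>j<m. a j * s j) = 0")
    case True
    then obtain a where nn: "\<And>x. 0 \<le> pol a x" and a: "\<exists>j<m. a j \<noteq> 0" "(\<Sum>j<m. a j * s j) = 0" by blast
    have Z: "finite {x. pol a x = 0}" "card {x. pol a x = 0} < k"
      using finite_zeros_of_nonneg[OF nn a(1)] by auto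
    have "\<forall>j<m. s j = (\<Sum>x | pol a x = 0. measure M {x} * monomials e j x)"
      using moments_concentrated_on_zeros[OF t1_space_euclidean_real R, of a] nn a(2) Z(1)
      by (simp add: pol)
    with Z show ?thesis
      by (intro exI[of _ "{x. pol a x = 0}"] exI[of _ "\<lambda>x. measure M {x}"]) auto
  next
    case False
    have "0 < (\<Sum>j<m. a j * s j)" if "\<And>x. 0 \<le> pol a x" "\<exists>j<m. a j \<noteq> 0" for a
      using False that nonneg_moment[OF R, of a] pol by (force simp: less_le)
    from interior_functional_atoms[OF this] show ?thesis by (simp add: monomials_def)
  qed
next
  fix N :: nat assume N: "\<And>s. moment_sequence euclidean m (monomials e) s \<Longrightarrow> \<exists>n\<le>N. \<exists>c x.
      (\<forall>i<n. 0 < c i \<and> x i \<in> topspace euclidean) \<and> (\<forall>j<m. s j = (\<Sum>i<n. c i * monomials e j (x i)))"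
  show "k \<le> N"
  proof (rule lower_bound_from_real_atoms[OF k])
    fix \<alpha> :: "nat \<Rightarrow> real" assume \<alpha>: "\<And>l. 0 \<le> \<alpha> l"
    define s where "s j = (\<Sum>l<m. \<alpha> l * (2 ^ l) ^ e j)" for j
    have "moment_sequence euclidean m (monomials e) s"
      unfolding moment_sequence_def s_def using \<alpha>
      by (intro exI[of _ "atoms euclidean m \<alpha> (\<lambda>l. 2 ^ l)"]
          representing_measure_atoms[OF t1_space_euclidean_real monomials_measurable])
        (auto simp: monomials_def)
    from N[OF this] obtain n c x where n: "n \<le> N" and c: "\<forall>i<n. 0 < c i"
      and sx: "\<forall>j<m. s j = (\<Sum>i<n. c i * x i ^ e j)"
      by (auto simp: monomials_def)
    have "s j = (\<Sum>i<n. (c i * (1 + (x i)\<^sup>2) ^ d) * hom_monomials (2 * d) e j (proj_point (x i)))"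
      if "j < m" for j
      using sx that e_le[OF that] by (simp add: mult.assoc hom_monomials_proj_point)
    then show "\<exists>n\<le>N. \<exists>c p. (\<forall>i<n. 0 < c i \<and> p i \<in> proj_line) \<and>
      (\<forall>j<m. (\<Sum>l<m. \<alpha> l * (2 ^ l) ^ e j) = (\<Sum>i<n. c i * hom_monomials (2 * d) e j (p i)))"
      using n c one_plus_square_pos unfolding s_def
      by (intro exI[of _ n] conjI exI[of _ "\<lambda>i. c i * (1 + (x i)\<^sup>2) ^ d"] exI[of _ "\<lambda>i. proj_point (x i)"])
        (auto simp: proj_point_in_proj_line)
  qed
qed

lemma caratheodory_number_hom_monomials:
  assumes k: "2 * k \<le> m + 1"
  shows "caratheodory_number proj_topology m (hom_monomials (2 * d) e) = k"
proof (rule caratheodory_number_eqI[OF t1_space_proj_topology form_measurable])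
  fix s M assume R: "representing_measure proj_topology m (hom_monomials (2 * d) e) s M"
  show "\<exists>Z w. finite Z \<and> Z \<subseteq> topspace proj_topology \<and> card Z \<le> k \<and> (\<forall>z. 0 \<le> w z) \<and>
      (\<forall>j<m. s j = (\<Sum>z\<in>Z. w z * hom_monomials (2 * d) e j z))"
  proof (cases "\<exists>a. (\<forall>x. 0 \<le> pol a x) \<and> (\<exists>j<m. a j \<noteq> 0) \<and> (\<Sum>j<m. a j * s j) = 0")
    case True
    then obtain a where nn: "\<And>x. 0 \<le> pol a x" and a: "\<exists>j<m. a j \<noteq> 0" "(\<Sum>j<m. a j * s j) = 0" by blast
    have Z: "finite {x. pol a x = 0}" "card {x. pol a x = 0} < k"
      using finite_zeros_of_nonneg[OF nn a(1)] by auto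
    define Y where "Y = {p \<in> proj_line. (\<Sum>j<m. a j * hom_monomials (2 * d) e j p) = 0}"
    have Y: "Y \<subseteq> insert (1, 0) (proj_point ` {x. pol a x = 0})" unfolding Y_def by (rule form_zeros)
    then have fin: "finite Y" using Z(1) finite_subset by blast
    have "card Y \<le> card (insert (1, 0) (proj_point ` {x. pol a x = 0}))"
      using Y Z(1) by (intro card_mono) auto
    also have "\<dots> \<le> Suc (card (proj_point ` {x. pol a x = 0}))" by (rule card_insert_le_m1) simp_all
    also have "\<dots> \<le> Suc (card {x. pol a x = 0})" using Z(1) by (simp add: card_image_le)
    finally have card: "card Y \<le> k" using Z(2) by simp
    have "\<forall>j<m. s j = (\<Sum>p\<in>Y. measure M {p} * hom_monomials (2 * d) e j p)"
      using moments_concentrated_on_zeros[OF t1_space_proj_topology R, of a] form_nonneg[OF nn] a(2) fin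
      by (simp add: topspace_proj_topology Y_def)
    with fin card show ?thesis
      by (intro exI[of _ Y] exI[of _ "\<lambda>p. measure M {p}"]) (auto simp: Y_def topspace_proj_topology)
  next
    case False
    have "0 < (\<Sum>j<m. a j * s j)" if "\<And>x. 0 \<le> pol a x" "\<exists>j<m. a j \<noteq> 0" for a
    proof -
      have "0 \<le> (\<Sum>j<m. a j * s j)"
        by (rule nonneg_moment[OF R]) (simp add: topspace_proj_topology form_nonneg[OF that(1)])
      moreover have "(\<Sum>j<m. a j * s j) \<noteq> 0" using False that by blast
      ultimately show ?thesis by linarith
    qed
    from interior_functional_atoms[OF this] obtain Z w where Z: "finite Z" "card Z \<le> k"
      and w: "\<forall>z. 0 \<le> w z" "\<forall>j<m. s j = (\<Sum>z\<in>Z. w z * z ^ e j)" by blast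
    have inj: "inj_on proj_point Z" by (rule inj_on_inverseI[of _ "\<lambda>p. fst p / snd p"]) (rule proj_point_ratio)
    define v where "v p = w (fst p / snd p) * (1 + (fst p / snd p)\<^sup>2) ^ d" for p
    have "s j = (\<Sum>p\<in>proj_point ` Z. v p * hom_monomials (2 * d) e j p)" if "j < m" for j
      using w(2) that unfolding sum.reindex[OF inj]
      by (simp add: v_def proj_point_ratio mult.assoc hom_monomials_proj_point e_le)
    moreover have "0 \<le> v p" for p using w(1) one_plus_square_pos by (simp add: v_def)
    moreover have "card (proj_point ` Z) \<le> k" using card_image_le[OF Z(1), of proj_point] Z(2) by simp
    ultimately show ?thesis using Z(1)
      by (intro exI[of _ "proj_point ` Z"] exI[of _ v])
        (auto simp: topspace_proj_topology proj_point_in_proj_line)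
  qed
next
  fix N :: nat assume N: "\<And>s. moment_sequence proj_topology m (hom_monomials (2 * d) e) s \<Longrightarrow> \<exists>n\<le>N. \<exists>c x.
      (\<forall>i<n. 0 < c i \<and> x i \<in> topspace proj_topology) \<and>
      (\<forall>j<m. s j = (\<Sum>i<n. c i * hom_monomials (2 * d) e j (x i)))"
  show "k \<le> N"
  proof (rule lower_bound_from_real_atoms[OF k])
    fix \<alpha> :: "nat \<Rightarrow> real" assume \<alpha>: "\<And>l. 0 \<le> \<alpha> l"
    define s where "s j = (\<Sum>l<m. \<alpha> l * (2 ^ l) ^ e j)" for j
    have "representing_measure proj_topology m (hom_monomials (2 * d) e) s
        (atoms proj_topology m (\<lambda>l. \<alpha> l * (1 + (2 ^ l)\<^sup>2) ^ d) (\<lambda>l. proj_point (2 ^ l)))"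
    proof (rule representing_measure_atoms[OF t1_space_proj_topology form_measurable])
      show "0 \<le> \<alpha> l * (1 + (2 ^ l)\<^sup>2) ^ d" for l using \<alpha>[of l] by simp
      show "s j = (\<Sum>l<m. (\<alpha> l * (1 + (2 ^ l)\<^sup>2) ^ d) * hom_monomials (2 * d) e j (proj_point (2 ^ l)))"
        if "j < m" for j
        unfolding s_def by (intro sum.cong) (simp_all only: mult.assoc hom_monomials_proj_point[of e j d, OF e_le[OF that]])
    qed (simp_all add: topspace_proj_topology proj_point_in_proj_line)
    then have "moment_sequence proj_topology m (hom_monomials (2 * d) e) s"
      unfolding moment_sequence_def by blast
    from N[OF this] show "\<exists>n\<le>N. \<exists>c p. (\<forall>i<n. 0 < c i \<and> p i \<in> proj_line) \<and>
      (\<forall>j<m. (\<Sum>l<m. \<alpha> l * (2 ^ l) ^ e j) = (\<Sum>i<n. c i * hom_monomials (2 * d) e j (p i)))"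
      unfolding s_def topspace_proj_topology .
  qed
qed

end

theorem theorem45:
  fixes m d :: nat and e :: "nat \<Rightarrow> nat"
  assumes "m \<ge> 1"
    and "strict_mono_on {..<m} e"
    and "e 0 = 0"
    and "e (m - 1) = 2 * d"
    and "\<And>x. x \<in> schur_zeros m e \<Longrightarrow>
           \<exists>i<nat \<lceil>real m / 2\<rceil>. \<exists>j<nat \<lceil>real m / 2\<rceil>. i \<noteq> j \<and> x i = x j"
  shows "caratheodory_number euclidean m (monomials e) = nat \<lceil>real m / 2\<rceil> \<and>
         caratheodory_number proj_topology m (hom_monomials (2 * d) e) = nat \<lceil>real m / 2\<rceil> \<and>
         rank_number m (monomials e) = nat \<lceil>real m / 2\<rceil> \<and>
         rank_number m (hom_monomials (2 * d) e) = nat \<lceil>real m / 2\<rceil>"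
proof -
  define k where "k = nat \<lceil>real m / 2\<rceil>"
  have kc: "2 * k \<le> m + 1"
    using \<open>m \<ge> 1\<close> unfolding k_def by linarith
  have U: "hermite_unisolvent m e k"
    by (rule hermite_unisolvent_if_schur_zeros) (use assms(3,5) in \<open>auto simp: k_def\<close>)
  interpret sparse_monomials m d k e
    by unfold_locales (use assms U in auto)
  have "2 * d > 0" if "m \<ge> 2" using e_less[of 0] that by simp
  then have "rank_number m (hom_monomials (2 * d) e) = k"
    by (intro rank_number_hom_monomials[OF U kc] e_le)
  then show ?thesis
    using caratheodory_number_monomials[OF kc] caratheodory_number_hom_monomials[OF kc]
      rank_number_monomials[OF U kc] by (simp add: k_def)
qed

end
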